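(* Let $f:\mathbb{R}^2\to\mathbb{R}$ be a function that is differentiable at every point and whose gradient is nowhere zero, let $D$ be a connected component of $\{x\in\mathbb{R}^2: f(x)\neq 0\}$, and let $C$ be a connected component of the boundary $\partial D$ of $D$ in $\mathbb{R}^2$. Then $C\cup\{\infty\}$ is a Jordan curve in $\mathbb{S}^2=\mathbb{R}^2\cup\{\infty\}$.
   Context: $\mathbb{S}^2=\mathbb{R}^2\cup\{\infty\}$ is the one-point compactification of the plane. A Jordan curve in $\mathbb{S}^2$ is the image of a continuous injective map from a circle to $\mathbb{S}^2$. Differentiable means (Fréchet) differentiable at every point; the derivative is not assumed continuous. *)

theory Defs
  imports "HOL-Analysis.Analysis"
begin

text \<open>The point at infinity is \<^term>\<open>None\<close>; a point \<open>x\<close> of the plane is \<^term>\<open>Some x\<close>.\<close>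

abbreviation S2 :: "(real^2) option topology" where
  "S2 \<equiv> Alexandroff_compactification (euclidean :: (real^2) topology)"

definition Jordan_curve_in :: "'a topology \<Rightarrow> 'a set \<Rightarrow> bool" where
  "Jordan_curve_in X J \<longleftrightarrow>
     (\<exists>\<gamma>. continuous_map (top_of_set (sphere (0 :: real^2) 1)) X \<gamma> \<and>
          inj_on \<gamma> (sphere 0 1) \<and> J = \<gamma> ` sphere 0 1)"

end

theory Submission
  imports Defs
begin

text \<open>
  Identify the plane with \<open>\<complex>\<close>. Since \<open>f\<close> has no local extrema, every component of \<open>{f \<noteq> 0} \<inter> R\<close>, for a
  rectangle \<open>R\<close>, reaches the boundary of \<open>R\<close>; by a Sard type argument almost every horizontal or vertical
  line meets \<open>{f = 0}\<close> in isolated points only. Hence there are arbitrarily small rectangles around any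
  point in which \<open>{f \<noteq> 0}\<close> has only finitely many components, and it follows that an open set whose
  frontier lies in \<open>{f = 0}\<close> is accessible by paths from each of its frontier points.

  Let \<open>M\<close> be the component of \<open>- D\<close> containing \<open>C\<close>. Then \<open>C = frontier M\<close> because the plane is unicoherent, and
  \<open>C\<close> is the common frontier of \<open>U = - M\<close> and \<open>G = interior M\<close>. Both are connected. For \<open>G\<close>, two components
  of \<open>interior M\<close> cannot share two frontier points, as a Jordan curve in \<open>M\<close> through both would have its
  inside in \<open>M\<close>, nor exactly one, as their closures would then separate the plane. So their closures are
  disjoint, and they form a locally finite cover of the connected set \<open>C\<close>.

  Join two points \<open>a\<close>, \<open>b\<close> of \<open>C\<close> by an arc through \<open>G\<close> and an arc through \<open>U\<close>. Every other point of \<open>C\<close> inside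
  the resulting Jordan curve \<open>J\<close> is accessible from \<open>G\<close> and from \<open>U\<close>, so it lies on a crosscut separating
  \<open>a\<close> from \<open>b\<close>. A continuum in which every point separates two given points is an arc between them;
  therefore \<open>C\<close> is an arc from \<open>a\<close> to \<open>b\<close> inside \<open>J\<close>. After an inversion about a point inside \<open>J\<close> the same
  holds for the part of \<open>C\<close> outside \<open>J\<close> together with the point at infinity.
\<close>

section \<open>Arcs as continua with separating points\<close>

lemma connected_closed_cover_disjoint:
  assumes "connected T" "closed A" "closed B" "T \<subseteq> A \<union> B" "T \<inter> (A \<inter> B) = {}" "T \<inter> A \<noteq> {}"
  shows "T \<inter> B = {}"
  using assms unfolding connected_closed by blast

text \<open>In a separation of \<open>A\<close> the piece missing \<open>p\<close> would also be
  separated from the other piece together with \<open>B\<close>.\<close>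

lemma connected_closed_Un_singleton:
  fixes A B :: "'a::t1_space set"
  assumes "connected (A \<union> B)" "closed A" "closed B" "A \<inter> B = {p}"
  shows "connected A"
proof (rule ccontr)
  assume "\<not> connected A"
  then obtain U V where UV: "closed U" "closed V" "A = U \<union> V" "U \<inter> V = {}" "U \<noteq> {}" "V \<noteq> {}"
    using connected_closed_set[OF \<open>closed A\<close>] by metis
  have *: False if "closed U" "closed V" "A = U \<union> V" "U \<inter> V = {}" "V \<noteq> {}" "p \<in> U" for U V
  proof -
    have "closed (U \<union> B)" "A \<union> B \<subseteq> (U \<union> B) \<union> V" "(U \<union> B) \<inter> V \<inter> (A \<union> B) = {}"
      using that assms by (auto)
    then show False
      using assms(1) that unfolding connected_closed by blast
  qed
  show False
    using *[of U V] *[of V U] UV assms by blast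
qed

text \<open>Every point \<open>p\<close> of \<open>P\<close> separates \<open>a\<close> from \<open>b\<close> in \<open>S\<close>; the two sides, each with \<open>p\<close> added,
  are \<open>L p\<close> and \<open>R p\<close>. The sets \<open>L p\<close> are nested, which orders \<open>P\<close> from \<open>a\<close> to \<open>b\<close>.\<close>

locale cut_points =
  fixes S :: "'a::euclidean_space set" and a b :: 'a and P :: "'a set" and L R :: "'a \<Rightarrow> 'a set"
  assumes compact: "compact S" and connected: "connected S" and P: "P \<subseteq> S"
    and closed_L: "p \<in> P \<Longrightarrow> closed (L p)" and closed_R: "p \<in> P \<Longrightarrow> closed (R p)"
    and Un: "p \<in> P \<Longrightarrow> L p \<union> R p = S" and Int: "p \<in> P \<Longrightarrow> L p \<inter> R p = {p}"
    and a: "p \<in> P \<Longrightarrow> a \<in> L p" and b: "p \<in> P \<Longrightarrow> b \<in> R p"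
begin

lemma swap: "cut_points S b a P R L"
  by unfold_locales (use compact connected P closed_L closed_R a b in \<open>simp_all add: Un Int Un_commute Int_commute\<close>)

lemma self: "p \<in> P \<Longrightarrow> p \<in> L p \<and> p \<in> R p"
  using Int by blast

lemma mem_S: "p \<in> P \<Longrightarrow> x \<in> S \<longleftrightarrow> x \<in> L p \<or> x \<in> R p"
  using Un by blast

lemma mem_both: "\<lbrakk>p \<in> P; x \<in> L p; x \<in> R p\<rbrakk> \<Longrightarrow> x = p"
  using Int by blast

lemma connected_L: "p \<in> P \<Longrightarrow> connected (L p)"
  using connected_closed_Un_singleton[of "L p" "R p" p] connected Un Int closed_L closed_R by simp

text \<open>\<open>L p\<close> is connected and contains \<open>a\<close>. It is covered by
  \<open>L q\<close> and \<open>R q\<close> and misses their only common point \<open>q\<close>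
  unless \<open>q = p\<close>, so it cannot reach \<open>R q\<close>.\<close>

lemma L_mono:
  assumes "p \<in> P" "q \<in> P" "q \<in> R p"
  shows "L p \<subseteq> L q" "R q \<subseteq> R p"
proof -
  have disj: "L p \<inter> R q = {}" if "q \<noteq> p"
  proof (rule connected_closed_cover_disjoint[where A = "L q"])
    show "L p \<inter> (L q \<inter> R q) = {}"
      using Int[of q] mem_both[of p q] assms that by auto
    show "L p \<inter> L q \<noteq> {}"
      using a[of p] a[of q] assms by blast
    show "L p \<subseteq> L q \<union> R q"
      using Un[of p] Un[of q] assms by auto
  qed (use assms connected_L closed_L closed_R in auto)
  show "L p \<subseteq> L q" "R q \<subseteq> R p"
    using disj mem_S[OF assms(1)] mem_S[OF assms(2)] by (cases "p = q"; blast)+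
qed

lemma R_mono:
  assumes "p \<in> P" "q \<in> P" "q \<in> L p"
  shows "R p \<subseteq> R q" "L q \<subseteq> L p"
  using cut_points.L_mono[OF swap assms] by auto

lemma antisym: "\<lbrakk>p \<in> P; q \<in> P; q \<in> L p; p \<in> L q\<rbrakk> \<Longrightarrow> p = q"
  using R_mono[of p q] mem_both[of q] self[of p] by blast

text \<open>Together with \<open>L p\<close> the segment makes up the connected set
  \<open>L q\<close>, and it meets \<open>L p\<close> in \<open>p\<close> only.\<close>

lemma connected_segment:
  assumes "p \<in> P" "q \<in> P" "q \<in> R p"
  shows "connected (R p \<inter> L q)"
proof (rule connected_closed_Un_singleton[of _ "L p"])
  have "(R p \<inter> L q) \<union> L p = L q"
    using L_mono[OF assms] Un[of p] Un[of q] assms by blast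
  then show "connected ((R p \<inter> L q) \<union> L p)"
    using connected_L assms by simp
  show "R p \<inter> L q \<inter> L p = {p}"
    using L_mono[OF assms] Int[of p] assms by blast
qed (use assms closed_L closed_R in auto)

text \<open>If all points of \<open>S\<close> but one are known to separate \<open>a\<close> from \<open>b\<close>, so does the remaining one.
  This takes care of the point at infinity, where nothing is known about the curve.\<close>

lemma closed_exceptional:
  assumes z: "z \<in> S" "P = S - {z}" and "b \<noteq> z" and Rb: "R b = {b}"
  shows "closed (insert z {p \<in> P. z \<in> L p})"
proof -
  define A where "A = {p \<in> P. z \<in> R p}"
  define B where "B = {p \<in> P. z \<in> L p}"
  have "z \<in> L p \<longleftrightarrow> z \<notin> R p" if "p \<in> P" for p
    using Un[OF that] Int[OF that] that z by auto
  then have AB: "A \<union> B = P" "A \<inter> B = {}"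
    unfolding A_def B_def by auto
  have bS: "b \<in> S" if "P \<noteq> {}"
    using that b mem_S by blast
  have sub: "insert z B \<subseteq> S \<inter> (\<Inter>p\<in>A. R p)"
  proof -
    have "q \<in> R p" if "p \<in> A" "q \<in> B" for p q
    proof (rule ccontr)
      assume "q \<notin> R p"
      then have "q \<in> L p"
        using Un[of p] that P unfolding A_def B_def by auto
      then have "R p \<subseteq> R q"
        using R_mono(1)[of p q] that unfolding A_def B_def by blast
      then show False
        using that AB unfolding A_def B_def by blast
    qed
    then show ?thesis
      using z P unfolding A_def B_def by auto
  qed
  \<comment> \<open>The question is whether the set \<open>A\<close> of points before
    \<open>z\<close> has a last point. If not, the set in question is an intersection of closed
    sets. If there is one, it would leave a gap before \<open>z\<close>, which is refuted.\<close>
  have "closed (insert z B)"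
  proof (cases "\<exists>x\<in>A. \<forall>p\<in>A. x \<in> R p")
    case False
    then have "S \<inter> (\<Inter>p\<in>A. R p) \<subseteq> insert z B"
      using AB z by blast
    then have "insert z B = S \<inter> (\<Inter>p\<in>A. R p)"
      using sub by blast
    moreover have "closed (S \<inter> (\<Inter>p\<in>A. R p))"
      using compact_imp_closed[OF compact] closed_R unfolding A_def by (intro closed_Int closed_INT) auto
    ultimately show ?thesis by simp
  next
    case True
    then obtain x where x: "x \<in> A" "\<And>p. p \<in> A \<Longrightarrow> x \<in> R p" by blast
    have xP: "x \<in> P" and xz: "x \<noteq> z" and zx: "z \<in> R x"
      using x z unfolding A_def by auto
    have Rx: "R x - {x} \<subseteq> insert z B"
    proof
      fix y assume y: "y \<in> R x - {x}"
      show "y \<in> insert z B"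
      proof (rule ccontr)
        assume "y \<notin> insert z B"
        then have yA: "y \<in> A"
          using AB z y mem_S[OF xP] by blast
        then have "x \<in> R y" using x by blast
        then have "L y \<subseteq> L x" "y \<in> P"
          using L_mono(1) xP yA unfolding A_def by blast+
        then show False
          using self[of y] y Int[OF xP] by blast
      qed
    qed
    \<comment> \<open>The segments from \<open>x\<close> to \<open>q \<in> B\<close> form a chain of continua with at most three common points.\<close>
    define F where "F = (\<lambda>q. R x \<inter> L q) ` B"
    have BR: "q \<in> R x" "q \<in> P" "z \<in> L q" if "q \<in> B" for q
      using sub x that unfolding B_def by auto
    have "connected (\<Inter>F)"
    proof (rule connected_chain)
      fix T assume "T \<in> F"
      then obtain q where q: "q \<in> B" "T = R x \<inter> L q" unfolding F_def by blast
      moreover have "T \<subseteq> S" using q mem_S xP by blast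
      ultimately show "compact T \<and> connected T"
        using connected_segment[of x q] BR xP compact closed_L closed_R
        by (metis bounded_subset closed_Int compact_eq_bounded_closed)
    next
      fix T T' assume "T \<in> F \<and> T' \<in> F"
      then obtain q q' where q: "q \<in> B" "T = R x \<inter> L q" "q' \<in> B" "T' = R x \<inter> L q'" unfolding F_def by blast
      then have "q' \<in> L q \<or> q' \<in> R q"
        using mem_S[of q q'] BR[of q] BR[of q'] P by blast
      then show "T \<subseteq> T' \<or> T' \<subseteq> T"
        using q L_mono(1)[of q q'] R_mono(2)[of q q'] BR(2)[of q] BR(2)[of q'] by blast
    qed
    moreover have bB: "b \<in> B"
    proof -
      have "b \<in> P" using bS z xP \<open>b \<noteq> z\<close> by blast
      moreover have "z \<in> L b"
      proof (rule ccontr)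
        assume "z \<notin> L b"
        then have "z \<in> R b" using mem_S[OF \<open>b \<in> P\<close>] z by blast
        then show False using Rb \<open>b \<noteq> z\<close> by simp
      qed
      ultimately show ?thesis unfolding B_def by blast
    qed
    moreover have mem_F: "y \<in> \<Inter>F \<longleftrightarrow> (\<forall>q\<in>B. y \<in> R x \<and> y \<in> L q)" for y
      unfolding F_def Inter_iff by auto
    moreover have "finite (\<Inter>F)"
    proof -
      have eq: "y = y'" if "y \<in> \<Inter>F - {x, z}" "y' \<in> \<Inter>F - {x, z}" for y y'
      proof -
        have yB: "y \<in> B" "y' \<in> B"
          using that bB Rx mem_F by blast+
        then have "y \<in> L y'" "y' \<in> L y"
          using that mem_F by blast+
        then show "y = y'"
          using antisym BR(2) yB by blast
      qed
      have "\<exists>y. \<Inter>F - {x, z} \<subseteq> {y}"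
      proof (cases "\<Inter>F - {x, z} = {}")
        case False
        then obtain y where "y \<in> \<Inter>F - {x, z}" by blast
        then have "\<Inter>F - {x, z} \<subseteq> {y}"
          using eq by blast
        then show ?thesis by blast
      qed blast
      then have "finite (\<Inter>F - {x, z})"
        by (meson finite.emptyI finite.insertI finite_subset)
      then show ?thesis by simp
    qed
    \<comment> \<open>A finite nonempty connected set is a single point, but both \<open>x\<close>
      and \<open>z\<close> will turn out to lie in this one.\<close>
    ultimately obtain y where y: "\<Inter>F \<subseteq> {y}"
      using connected_finite_iff_sing[of "\<Inter>F"] by auto
    have "x \<in> L q" if "q \<in> B" for q
      using L_mono(1)[OF xP BR(2) BR(1)] that self[OF xP] by blast
    then have "x \<in> \<Inter>F"
      using self[OF xP] mem_F by blast
    moreover have "z \<in> \<Inter>F"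
      using BR(3) zx mem_F by blast
    ultimately have "x = z" using y by blast
    then show ?thesis using xz by blast
  qed
  then show ?thesis unfolding B_def .
qed

section \<open>Monotone parametrization of a continuum ordered by its cut points\<close>

lemma R_iff_L: "\<lbrakk>p \<in> P; q \<in> P\<rbrakk> \<Longrightarrow> q \<in> R p \<longleftrightarrow> p \<in> L q"
  using L_mono(1)[of p q] antisym[of p q] self[of p] mem_S[of p q] mem_S[of q q] self[of q] mem_S[of p] P by blast

text \<open>Running suprema along the order are continuous and monotone; countably many of them,
  summed with weights, parametrize \<open>S\<close>.\<close>

lemma continuous_SUP_L:
  fixes u :: "'a \<Rightarrow> real"
  assumes PS: "P = S" and u: "continuous_on UNIV u"
  shows "continuous_on S (\<lambda>x. SUP w\<in>L x. u w)"
proof -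
  define G where "G x = (SUP w\<in>L x. u w)" for x
  have cpt: "compact (L x)" if "x \<in> S" for x
    using that PS closed_L compact Un by (metis compact_Int_closed sup_ge1 inf.absorb_iff2 inf_commute)
  have up: "u w \<le> G x" if "x \<in> S" "w \<in> L x" for x w
    unfolding G_def
    using that cpt[of x] u by (intro cSUP_upper bounded_imp_bdd_above compact_imp_bounded compact_continuous_image)
       (auto intro: continuous_on_subset)
  have attain: "\<exists>m\<in>L x. G x = u m" if x: "x \<in> S" for x
  proof -
    obtain m where m: "m \<in> L x" "\<And>w. w \<in> L x \<Longrightarrow> u w \<le> u m"
      using continuous_attains_sup[OF cpt[OF x], of u] a x PS continuous_on_subset[OF u] by (metis empty_iff subset_UNIV)
    then have "G x = u m"
      unfolding G_def by (intro cSup_eq_maximum) auto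
    then show ?thesis using m by blast
  qed
  have L_sub: "L w \<subseteq> L x" if "x \<in> S" "w \<in> L x" for x w
    using R_mono(2)[of x w] that PS mem_S by blast
  \<comment> \<open>A nonempty superlevel set is \<open>R m\<close> for the first point
    \<open>m\<close> with \<open>c \<le> u m\<close>. This point comes from the chain of nonempty
    compact sets \<open>L w \<inter> F\<close>.\<close>
  have ge: "closed {x \<in> S. c \<le> G x}" for c
  proof (cases "\<exists>w\<in>S. c \<le> u w")
    case False
    then have "{x \<in> S. c \<le> G x} = {}"
      using attain mem_S PS by (metis (mono_tags, lifting) Collect_empty_eq)
    then show ?thesis by (metis closed_empty)
  next
    case True
    define F where "F = {w \<in> S. c \<le> u w}"
    have cF: "compact F"
    proof -
      have "closed {w. c \<le> u w}"
        using u by (intro closed_Collect_le) auto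
      then show ?thesis
        using compact unfolding F_def by (simp add: Collect_conj_eq compact_Int_closed)
    qed
    have "\<Inter>((\<lambda>w. L w \<inter> F) ` F) \<noteq> {}"
    proof (rule compact_chain)
      show "\<And>T. T \<in> (\<lambda>w. L w \<inter> F) ` F \<Longrightarrow> compact T"
        using cF closed_L PS F_def by auto
      show "{} \<notin> (\<lambda>w. L w \<inter> F) ` F"
        using self PS F_def by auto
      fix T T' assume "T \<in> (\<lambda>w. L w \<inter> F) ` F \<and> T' \<in> (\<lambda>w. L w \<inter> F) ` F"
      then obtain w w' where "w \<in> S" "w' \<in> S" "T = L w \<inter> F" "T' = L w' \<inter> F"
        unfolding F_def by blast
      then show "T \<subseteq> T' \<or> T' \<subseteq> T"
        using L_mono(1)[of w w'] L_sub[of w w'] mem_S[of w w'] PS by blast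
    qed
    then obtain m where "\<And>w. w \<in> F \<Longrightarrow> m \<in> L w \<inter> F"
      unfolding ex_in_conv[symmetric] Inter_iff by (metis imageI)
    moreover have "F \<noteq> {}" using True unfolding F_def by blast
    ultimately have m: "m \<in> F" "\<And>w. w \<in> F \<Longrightarrow> m \<in> L w"
      by blast+
    have "{x \<in> S. c \<le> G x} = R m"
    proof (intro equalityI subsetI)
      fix x assume "x \<in> {x \<in> S. c \<le> G x}"
      then obtain w where w: "x \<in> S" "w \<in> L x" "c \<le> u w"
        using attain by force
      then have "w \<in> F" using mem_S PS unfolding F_def by blast
      then have "m \<in> L x" using m L_sub w by blast
      then show "x \<in> R m"
        using R_iff_L[of m x] m w PS unfolding F_def by blast
    next
      fix x assume x: "x \<in> R m"
      then have "x \<in> S" "m \<in> S" using m mem_S PS unfolding F_def by blast+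
      then show "x \<in> {x \<in> S. c \<le> G x}"
        using R_iff_L[of m x] x m up[of x m] PS unfolding F_def by auto
    qed
    then show ?thesis
      using closed_R m PS unfolding F_def by auto
  qed
  have le: "closed {x \<in> S. G x \<le> c}" for c
  proof (cases "u a \<le> c")
    case False
    then have "{x \<in> S. G x \<le> c} = {}"
      using up a PS by force
    then show ?thesis by (metis closed_empty)
  next
    case True
    have "{x \<in> S. G x \<le> c} = S \<inter> (\<Inter>w\<in>{w \<in> S. c < u w}. L w)"
    proof (intro equalityI subsetI)
      fix x assume x: "x \<in> {x \<in> S. G x \<le> c}"
      have "x \<in> L w" if "w \<in> S" "c < u w" for w
      proof -
        have "w \<notin> L x" using up[of x w] x that by force
        then show ?thesis using R_iff_L[of w x] mem_S[of w x] that x PS by blast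
      qed
      then show "x \<in> S \<inter> (\<Inter>w\<in>{w \<in> S. c < u w}. L w)" using x by blast
    next
      fix x assume x: "x \<in> S \<inter> (\<Inter>w\<in>{w \<in> S. c < u w}. L w)"
      \<comment> \<open>If \<open>u\<close> exceeds \<open>c\<close> somewhere on
        \<open>L x\<close>, it does so at \<open>x\<close> alone. Then \<open>x\<close> would be
        isolated in the connected set \<open>L x\<close>, which also contains
        \<open>a\<close>.\<close>
      have only: "w = x" if "w \<in> L x" "c < u w" for w
      proof -
        have "w \<in> S" using that x mem_S PS by blast
        then show ?thesis using that x antisym[of w x] PS by blast
      qed
      have "u w \<le> c" if w: "w \<in> L x" for w
      proof (rule ccontr)
        assume "\<not> u w \<le> c"
        then have ux: "c < u x" using only w by force
        have xS: "x \<in> S" using x by blast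
        have cl: "closed {w. u w \<le> c}"
          using u by (intro closed_Collect_le) auto
        have "L x \<inter> {w. u w \<le> c} = {}"
        proof (rule connected_closed_cover_disjoint[of _ "{x}"])
          show "L x \<subseteq> {x} \<union> {w. u w \<le> c}" using only by force
          show "L x \<inter> {x} \<noteq> {}" using self xS PS by blast
          show "L x \<inter> ({x} \<inter> {w. u w \<le> c}) = {}" using ux by auto
        qed (use connected_L xS PS cl in auto)
        then show False using a xS PS True by blast
      qed
      then show "x \<in> {x \<in> S. G x \<le> c}" using attain x by force
    qed
    moreover have "closed (S \<inter> (\<Inter>w\<in>{w \<in> S. c < u w}. L w))"
      using compact_imp_closed[OF compact] closed_L PS by (intro closed_Int closed_INT) auto
    ultimately show ?thesis by simp
  qed
  have ev: "eventually (\<lambda>y. y \<notin> T) (at x within S)" if "closed T" "x \<notin> T" for x T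
    using eventually_nhds_in_open[of "-T" x] that unfolding eventually_at_filter
    by (auto elim!: eventually_mono simp: open_Compl)
  have evS: "eventually (\<lambda>y. y \<in> S) (at x within S)" for x
    by (simp add: eventually_at_filter)
  show ?thesis
    unfolding continuous_on_def G_def[symmetric]
  proof (intro ballI order_tendstoI)
    fix x c assume "x \<in> S" "c < G x"
    then show "eventually (\<lambda>y. c < G y) (at x within S)"
      using ev[OF le[of c], of x] evS[of x] by (auto elim: eventually_elim2)
  next
    fix x c assume "x \<in> S" "G x < c"
    then show "eventually (\<lambda>y. G y < c) (at x within S)"
      using ev[OF ge[of c], of x] evS[of x] by (auto elim: eventually_elim2)
  qed
qed

lemma ex_strict_mono:
  assumes PS: "P = S"
  obtains h :: "'a \<Rightarrow> real" where "continuous_on S h" "\<And>x y. \<lbrakk>y \<in> S; x \<in> L y; x \<noteq> y\<rbrakk> \<Longrightarrow> h x < h y"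
proof -
  obtain Q :: "'a set" where Q: "countable Q" "\<And>X. \<lbrakk>open X; X \<noteq> {}\<rbrakk> \<Longrightarrow> \<exists>d\<in>Q. d \<in> X"
    using countable_dense_exists by blast
  define I where "I = Q \<times> (UNIV :: nat set)"
  have I: "countable I" "I \<noteq> {}"
    using Q(1) Q(2)[of UNIV] unfolding I_def by auto
  define e :: "nat \<Rightarrow> 'a \<times> nat" where "e = from_nat_into I"
  \<comment> \<open>\<open>u n\<close> is a tent with peak at \<open>q\<close> and radius
    \<open>1 / Suc k\<close>, where \<open>(q, k)\<close> is the \<open>n\<close>-th pair. If
    \<open>x\<close> strictly precedes \<open>y\<close>, some tent lives near \<open>y\<close> and
    off the closed set \<open>L x\<close>; its running supremum is 0 at \<open>x\<close> and
    positive at \<open>y\<close>.\<close>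
  define u where "u n w = max 0 (1 / real (Suc (snd (e n))) - dist w (fst (e n)))" for n w
  define G where "G n x = (SUP w\<in>L x. u n w)" for n x
  have u01: "0 \<le> u n w" "u n w \<le> 1" for n w
  proof -
    have "1 / real (Suc (snd (e n))) \<le> 1" by (simp add: divide_simps)
    then show "0 \<le> u n w" "u n w \<le> 1"
      unfolding u_def using zero_le_dist[of w "fst (e n)"] by linarith+
  qed
  have ne: "L x \<noteq> {}" if "x \<in> S" for x using a that PS by blast
  have bdd: "bdd_above (u n ` L x)" for n x
    using u01 by (meson bdd_aboveI2)
  have up: "u n w \<le> G n x" if "w \<in> L x" for n w x
    unfolding G_def using that bdd by (rule cSUP_upper)
  have G01: "0 \<le> G n x" "G n x \<le> 1" if "x \<in> S" for n x
  proof -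
    show "G n x \<le> 1" unfolding G_def using ne[OF that] u01 by (intro cSUP_least) auto
    show "0 \<le> G n x" using up[OF a, of x n] u01[of n a] that PS by force
  qed
  have contG: "continuous_on S (G n)" for n
    unfolding G_def u_def by (intro continuous_SUP_L PS continuous_intros)
  define h where "h x = (\<Sum>n. (1/2)^n * G n x)" for x
  have le: "norm ((1/2)^n * G n x) \<le> (1/2)^n" if "x \<in> S" for n x
    using G01[OF that, of n] by (simp add: mult_le_cancel_left1)
  have summ: "summable (\<lambda>n. (1/2)^n * G n x)" if "x \<in> S" for x
    by (rule summable_comparison_test'[of "\<lambda>n. (1/2)^n" 0]) (use le[OF that] in auto)
  have "continuous_on S h"
  proof (rule uniform_limit_theorem)
    show "uniform_limit S (\<lambda>N x. \<Sum>n<N. (1/2)^n * G n x) h sequentially"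
      unfolding h_def by (rule Weierstrass_m_test[of S _ "\<lambda>n. (1/2)^n"]) (use le in auto)
    show "\<forall>\<^sub>F N in sequentially. continuous_on S (\<lambda>x. \<Sum>n<N. (1/2)^n * G n x)"
      by (intro always_eventually allI continuous_intros contG)
  qed simp
  moreover have "h x < h y" if y: "y \<in> S" and xy: "x \<in> L y" "x \<noteq> y" for x y
  proof -
    have x: "x \<in> S" using xy y mem_S PS by blast
    have mono: "G n x \<le> G n y" for n
      unfolding G_def using ne[OF x] bdd R_mono(2)[of y x] x y xy PS by (intro cSUP_subset_mono) auto
    have "y \<notin> L x" using antisym[of x y] x y xy PS by blast
    moreover have "closed (L x)" using closed_L x PS by blast
    ultimately obtain r where r: "r > 0" "ball y r \<inter> L x = {}"
      by (metis Compl_iff disjoint_eq_subset_Compl inf_commute open_Compl open_contains_ball)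
    obtain k where k: "1 / real (Suc k) < r/2"
      using r by (metis half_gt_zero nat_approx_posE)
    obtain q where q: "q \<in> Q" "dist y q < 1 / real (Suc k)"
      using Q(2)[of "ball y (1 / real (Suc k))"] by auto
    obtain n where n: "e n = (q, k)"
      using from_nat_into_surj[OF I(1), of "(q,k)"] q unfolding e_def I_def by auto
    have "u n w = 0" if "w \<in> L x" for w
    proof -
      have "r \<le> dist y w" using r that by force
      then have "1 / real (Suc k) \<le> dist w q"
        using k q dist_triangle[of y w q] by (simp add: dist_commute)
      then show ?thesis unfolding u_def n by simp
    qed
    then have "G n x = (SUP w\<in>L x. 0)" unfolding G_def by (intro SUP_cong) auto
    then have "G n x = 0" using ne[OF x] by simp
    moreover have "0 < G n y"
    proof -
      have "0 < u n y" unfolding u_def n using q by simp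
      then show ?thesis using up[of y y n] self y PS by force
    qed
    ultimately have "0 < (\<Sum>n. (1/2)^n * G n y - (1/2)^n * G n x)"
      using mono by (intro suminf_pos2[where i = n] summable_diff summ x y) auto
    then show ?thesis
      unfolding h_def using suminf_diff[OF summ[OF y] summ[OF x]] by simp
  qed
  ultimately show ?thesis using that by blast
qed

text \<open>The strictly increasing \<open>h\<close> maps the compact connected set \<open>S\<close>
  homeomorphically onto an interval, and its inverse is the arc.\<close>

theorem ex_arc:
  assumes PS: "P = S" and "a \<in> S" "b \<in> S" "a \<noteq> b"
  obtains g where "arc g" "path_image g = S" "pathstart g = a" "pathfinish g = b"
proof -
  obtain h :: "'a \<Rightarrow> real" where h: "continuous_on S h" "\<And>x y. \<lbrakk>y \<in> S; x \<in> L y; x \<noteq> y\<rbrakk> \<Longrightarrow> h x < h y"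
    using ex_strict_mono[OF PS] by blast
  have inj: "inj_on h S"
  proof (rule inj_onI, rule ccontr)
    fix x y assume "x \<in> S" "y \<in> S" "h x = h y" "x \<noteq> y"
    then show False
      using h(2)[of x y] h(2)[of y x] R_iff_L[of x y] mem_S[of x y] PS by auto
  qed
  have Lb: "x \<in> L b" if "x \<in> S" for x
    using b[of x] R_iff_L[of x b] that assms by blast
  have bounds: "h a \<le> h x" "h x \<le> h b" if "x \<in> S" for x
    using h(2)[of x a] h(2)[of b x] a[of x] Lb that assms by force+
  have "h ` S = {h a..h b}"
  proof
    show "h ` S \<subseteq> {h a..h b}" using bounds by auto
    have "connected (h ` S)" using h(1) connected connected_continuous_image by blast
    then show "{h a..h b} \<subseteq> h ` S"
      using assms connected_contains_Icc by blast
  qed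
  then obtain k where k: "homeomorphism S {h a..h b} h k"
    using homeomorphism_compact[OF compact h(1) _ inj] by blast
  have lt: "h a < h b" using h(2)[of b a] Lb assms by blast
  define g where "g = k \<circ> (\<lambda>t. linepath (h a) (h b) t)"
  have lp: "path_image (linepath (h a) (h b)) = {h a..h b}"
    using lt by (simp add: closed_segment_eq_real_ivl)
  have "arc g"
    unfolding g_def comp_def arc_def
  proof
    show "path (\<lambda>t. k (linepath (h a) (h b) t))"
      using path_continuous_image[of "linepath (h a) (h b)" k] k lp
      unfolding homeomorphism_def comp_def by simp
    have "inj_on k {h a..h b}"
      using k unfolding homeomorphism_def by (metis inj_on_inverseI)
    then show "inj_on (\<lambda>t. k (linepath (h a) (h b) t)) {0..1}"
      using comp_inj_on[of "linepath (h a) (h b)" "{0..1}" k] lp lt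
      by (simp add: path_image_def comp_def inj_on_linepath)
  qed
  moreover have "path_image g = S"
    using k lp unfolding g_def path_image_compose homeomorphism_def comp_def[symmetric] by (simp add: path_image_def image_image)
  moreover have "pathstart g = a" "pathfinish g = b"
    using k assms unfolding g_def pathstart_def pathfinish_def homeomorphism_def
    by (auto simp: linepath_def)
  ultimately show ?thesis using that by blast
qed

end

text \<open>No separation is assumed at the single point \<open>z\<close>. If \<open>z\<close> lies
  in \<open>S\<close>, then \<open>closed_exceptional\<close> and its mirror image show that the two
  sides of \<open>z\<close> are closed, which makes \<open>z\<close> a cut point as well.\<close>

lemma arc_of_separating_points:
  fixes S :: "'a::euclidean_space set"
  assumes "compact S" "connected S" "a \<in> S" "b \<in> S" "a \<noteq> b" "z \<noteq> a" "z \<noteq> b"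
    and sep: "\<And>p. p \<in> S - {a,b,z} \<Longrightarrow>
      \<exists>A B. closed A \<and> closed B \<and> A \<union> B = S \<and> A \<inter> B = {p} \<and> a \<in> A \<and> b \<in> B"
  obtains g where "arc g" "path_image g = S" "pathstart g = a" "pathfinish g = b"
proof -
  have "\<exists>L R. \<forall>p. p \<in> S - {a,b,z} \<longrightarrow>
      closed (L p) \<and> closed (R p) \<and> L p \<union> R p = S \<and> L p \<inter> R p = {p} \<and> a \<in> L p \<and> b \<in> R p"
    using sep by metis
  then obtain L0 R0 where LR0: "\<And>p. p \<in> S - {a,b,z} \<Longrightarrow>
      closed (L0 p) \<and> closed (R0 p) \<and> L0 p \<union> R0 p = S \<and> L0 p \<inter> R0 p = {p} \<and> a \<in> L0 p \<and> b \<in> R0 p"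
    by blast
  \<comment> \<open>The ends get the trivial cuts. \<open>closed_exceptional\<close> relies on
    \<open>R b = {b}\<close>, and its mirror image on \<open>L a = {a}\<close>.\<close>
  define L where "L p = (if p = a then {a} else if p = b then S else L0 p)" for p
  define R where "R p = (if p = a then S else if p = b then {b} else R0 p)" for p
  have LR: "closed (L p) \<and> closed (R p) \<and> L p \<union> R p = S \<and> L p \<inter> R p = {p} \<and> a \<in> L p \<and> b \<in> R p"
    if "p \<in> S - {z}" for p
    using LR0[of p] that assms compact_imp_closed[of S] unfolding L_def R_def by auto
  interpret Z: cut_points S a b "S - {z}" L R
    by unfold_locales (use LR assms in auto)
  show ?thesis
  proof (cases "z \<in> S")
    case False
    then show ?thesis using Z.ex_arc[of thesis] assms that by auto
  next
    case z: True
    define A where "A = insert z {p \<in> S - {z}. z \<in> R p}"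
    define B where "B = insert z {p \<in> S - {z}. z \<in> L p}"
    have "closed B"
      unfolding B_def by (rule Z.closed_exceptional) (use z assms in \<open>auto simp: R_def\<close>)
    moreover have "closed A"
      unfolding A_def by (rule cut_points.closed_exceptional[OF Z.swap]) (use z assms in \<open>auto simp: L_def\<close>)
    moreover have "A \<union> B = S"
      using Z.mem_S z unfolding A_def B_def by blast
    moreover have "A \<inter> B = {z}"
      using Z.mem_both unfolding A_def B_def by blast
    moreover have "a \<in> A" "b \<in> B"
      using assms z unfolding A_def B_def L_def R_def by auto
    ultimately have "cut_points S a b S (L(z := A)) (R(z := B))"
      using LR assms by unfold_locales auto
    then show ?thesis using cut_points.ex_arc[of S a b S "L(z := A)" "R(z := B)" thesis] assms that by blast
  qed
qed

section \<open>Generic lines are transversal to the zero set\<close>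

text \<open>The one-dimensional case of \<open>baby_Sard\<close>, passed through
  \<open>real^1\<close>. The derivative is taken within \<open>Y\<close> because the function in the
  application is meaningful on \<open>Y\<close> only.\<close>

lemma negligible_image_derivative_zero:
  fixes g :: "real \<Rightarrow> real"
  assumes "\<And>y. y \<in> Y \<Longrightarrow> (g has_derivative (\<lambda>_. 0)) (at y within Y)"
  shows "negligible (g ` Y)"
proof -
  let ?F = "\<lambda>v::real^1. vec (g (v $ 1)) :: real^1"
  have "negligible (?F ` (vec ` Y))"
  proof (rule baby_Sard)
    fix x :: "real^1" assume "x \<in> vec ` Y"
    then obtain y where y: "y \<in> Y" "x = vec y" by blast
    show "(?F has_derivative (*\<^sub>R) 0) (at x within vec ` Y)"
      unfolding y by (rule has_derivative_vector_1) (use assms[OF y(1)] in simp)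
    have "matrix ((*\<^sub>R) (0::real)) = (0 :: real^1^1)"
      by (simp add: matrix_def vec_eq_iff)
    then show "rank (matrix ((*\<^sub>R) 0 :: real^1 \<Rightarrow> real^1)) < CARD(1)"
      by simp
  qed simp
  then have "negligible ((\<lambda>v::real^1. v $ 1) ` (?F ` (vec ` Y)))"
    by (rule negligible_differentiable_image_negligible[rotated])
       (auto intro!: linear_imp_differentiable_on bounded_linear.linear bounded_linear_vec_nth)
  then show ?thesis by (simp add: image_image)
qed

text \<open>Near a zero with vertical level direction the zero set is so steep that, on countably many pieces,
  it is a graph over the imaginary axis whose derivative vanishes. Only zeros are considered,
  so no regularity beyond differentiability is needed.\<close>

lemma negligible_Re_critical_zeros:
  fixes f :: "complex \<Rightarrow> real"
  assumes der: "\<And>z. (f has_derivative f' z) (at z)" and nz: "\<And>z. f' z \<noteq> (\<lambda>_. 0)"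
  shows "negligible (Re ` {z. f z = 0 \<and> f' z \<i> = 0})"
proof -
  define S where "S = {z. f z = 0 \<and> f' z \<i> = 0}"
  \<comment> \<open>At \<open>z\<close> the derivative is a nonzero multiple of \<open>Re\<close>,
    and \<open>f\<close> vanishes at both \<open>z\<close> and \<open>w\<close>. So
    differentiability at \<open>z\<close> alone confines the nearby points of \<open>S\<close> to a
    thin cone around the vertical through \<open>z\<close>.\<close>
  have tangent: "\<exists>d>0. \<forall>w\<in>S. dist w z < d \<longrightarrow> \<bar>Re w - Re z\<bar> \<le> e * dist w z" if z: "z \<in> S" and e: "e > 0" for z e
  proof -
    have lin: "linear (f' z)" using der has_derivative_linear by blast
    have f'eq: "f' z h = Re h * f' z 1" for h
    proof -
      have "f' z h = f' z (Re h *\<^sub>R 1 + Im h *\<^sub>R \<i>)"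
        by (rule arg_cong[of _ _ "f' z"]) (simp add: complex_eq_iff)
      also have "\<dots> = Re h * f' z 1 + Im h * f' z \<i>"
        by (simp add: linear_add[OF lin] linear_scale[OF lin])
      finally show ?thesis using z unfolding S_def by simp
    qed
    then have a: "f' z 1 \<noteq> 0" using nz[of z] by (metis mult_zero_right)
    obtain d where d: "d > 0" "\<And>w. norm (w - z) < d \<Longrightarrow> norm (f w - f z - f' z (w - z)) \<le> (e * \<bar>f' z 1\<bar>) * norm (w - z)"
      using der[of z] e a unfolding has_derivative_at_alt by (metis mult_pos_pos zero_less_abs_iff)
    have "\<bar>Re w - Re z\<bar> \<le> e * dist w z" if "w \<in> S" "dist w z < d" for w
    proof -
      have "\<bar>Re w - Re z\<bar> * \<bar>f' z 1\<bar> \<le> (e * dist w z) * \<bar>f' z 1\<bar>"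
        using d(2)[of w] that z f'eq[of "w - z"] unfolding S_def
        by (simp add: dist_norm abs_mult mult_ac)
      then show ?thesis using a by simp
    qed
    then show ?thesis using d by blast
  qed
  \<comment> \<open>The radius in \<open>tangent\<close> for slope 1/2 varies with \<open>z\<close>;
    \<open>SS k\<close> collects the points for which \<open>1 / Suc k\<close> works. Cutting with
    balls of half that radius makes any two points of one piece comparable.\<close>
  define SS where "SS k = {z \<in> S. \<forall>w\<in>S. dist w z < 1 / real (Suc k) \<longrightarrow> \<bar>Re w - Re z\<bar> \<le> 1/2 * dist w z}" for k
  obtain Q :: "complex set" where Q: "countable Q" "\<And>X. \<lbrakk>open X; X \<noteq> {}\<rbrakk> \<Longrightarrow> \<exists>d\<in>Q. d \<in> X"
    using countable_dense_exists by blast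
  define T where "T k q = SS k \<inter> ball q (1 / (2 * real (Suc k)))" for k q
  have "negligible (Re ` T k q)" for k q
  proof -
    have near: "dist w z < 1 / real (Suc k)" if "w \<in> T k q" "z \<in> T k q" for w z
    proof -
      have "dist w z \<le> dist q w + dist q z" by (rule dist_triangle3)
      also have "\<dots> < 1 / (2 * real (Suc k)) + 1 / (2 * real (Suc k))"
        using that unfolding T_def by (intro add_strict_mono) auto
      also have "\<dots> = 1 / real (Suc k)" by (simp add: field_simps)
      finally show ?thesis .
    qed
    have flat: "dist w z \<le> 2 * \<bar>Im w - Im z\<bar>" if "w \<in> T k q" "z \<in> T k q" for w z
    proof -
      have "\<bar>Re w - Re z\<bar> \<le> 1/2 * dist w z"
        using near[OF that] that unfolding T_def SS_def by blast
      moreover have "dist w z \<le> \<bar>Re w - Re z\<bar> + \<bar>Im w - Im z\<bar>"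
        using cmod_le[of "w - z"] by (simp add: dist_norm)
      ultimately show ?thesis by argo
    qed
    have inj: "inj_on Im (T k q)"
      by (rule inj_onI) (use flat in force)
    \<comment> \<open>Each piece is the graph of \<open>g\<close> over its heights, and
      \<open>tangent\<close> with arbitrarily small slope gives \<open>g\<close> the derivative 0
      there.\<close>
    define g where "g = Re \<circ> the_inv_into (T k q) Im"
    have g: "g (Im z) = Re z" if "z \<in> T k q" for z
      unfolding g_def using the_inv_into_f_f[OF inj that] by simp
    have "(g has_derivative (\<lambda>_. 0)) (at y within Im ` T k q)" if yT: "y \<in> Im ` T k q" for y
    proof -
      obtain z where z: "z \<in> T k q" "y = Im z" using yT by blast
      have zS: "z \<in> S" using z unfolding T_def SS_def by blast
      have "\<exists>d>0. \<forall>x\<in>Im ` T k q. norm (x - y) < d \<longrightarrow> norm (g x - g y - 0) \<le> e * norm (x - y)" if e: "e > 0" for e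
      proof -
        obtain d where d: "d > 0" "\<And>w. \<lbrakk>w \<in> S; dist w z < d\<rbrakk> \<Longrightarrow> \<bar>Re w - Re z\<bar> \<le> (e/2) * dist w z"
          using tangent[OF zS, of "e/2"] e by auto
        have "norm (g x - g y - 0) \<le> e * norm (x - y)" if xT: "x \<in> Im ` T k q" and xd: "norm (x - y) < d/2" for x
        proof -
          obtain w where w: "w \<in> T k q" "x = Im w" using xT by blast
          have dd: "dist w z \<le> 2 * norm (x - y)" using flat[OF w(1) z(1)] w z by simp
          then have "\<bar>Re w - Re z\<bar> \<le> (e/2) * dist w z"
            using d(2)[of w] xd w unfolding T_def SS_def by auto
          also have "\<dots> \<le> (e/2) * (2 * norm (x - y))"
            using dd e by (intro mult_left_mono) auto
          finally show ?thesis using g w z by simp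
        qed
        then show ?thesis using d(1) by (intro exI[of _ "d/2"]) auto
      qed
      then show ?thesis
        unfolding has_derivative_within_alt by (simp add: bounded_linear_zero)
    qed
    then have "negligible (g ` (Im ` T k q))"
      by (rule negligible_image_derivative_zero)
    moreover have "g ` (Im ` T k q) = Re ` T k q"
      using g by (auto simp: image_image)
    ultimately show ?thesis by simp
  qed
  then have "negligible (\<Union>X\<in>(\<lambda>(k, q). Re ` T k q) ` (UNIV \<times> Q). X)"
    using Q(1) by (intro negligible_countable_Union countable_image countable_SIGMA) auto
  moreover have "Re ` S \<subseteq> (\<Union>X\<in>(\<lambda>(k, q). Re ` T k q) ` (UNIV \<times> Q). X)"
  proof -
    have "\<exists>k. \<exists>q\<in>Q. z \<in> T k q" if z: "z \<in> S" for z
    proof -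
      obtain d where d: "d > 0" "\<forall>w\<in>S. dist w z < d \<longrightarrow> \<bar>Re w - Re z\<bar> \<le> 1/2 * dist w z"
        using tangent[OF z, of "1/2"] by auto
      obtain k where k: "1 / real (Suc k) < d"
        using nat_approx_posE[OF d(1)] by blast
      obtain q where q: "q \<in> Q" "q \<in> ball z (1 / (2 * real (Suc k)))"
        using Q(2)[of "ball z (1 / (2 * real (Suc k)))"] by auto
      have "z \<in> SS k"
        unfolding SS_def using z d k by force
      then have "z \<in> T k q" using q unfolding T_def by (simp add: dist_commute)
      then show ?thesis using q by blast
    qed
    then show ?thesis by fastforce
  qed
  ultimately show ?thesis
    unfolding S_def by (rule negligible_subset)
qed

section \<open>Boxes in which the nonzero set has finitely many components\<close>

lemma isolated_zero_on_line:
  fixes f :: "complex \<Rightarrow> real"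
  assumes der: "(f has_derivative f') (at z)" and "f z = 0" "f' v \<noteq> 0"
  obtains d where "d > 0" "\<And>t. \<lbrakk>t \<noteq> 0; \<bar>t\<bar> < d\<rbrakk> \<Longrightarrow> f (z + t *\<^sub>R v) \<noteq> 0"
proof -
  have lin: "linear f'" using der has_derivative_linear by blast
  then have v: "norm v > 0" using assms(3) linear_0 by auto
  define e where "e = \<bar>f' v\<bar> / (2 * norm v)"
  have e: "e > 0" unfolding e_def using assms v by simp
  obtain d where d: "d > 0" "\<And>w. norm (w - z) < d \<Longrightarrow> norm (f w - f z - f' (w - z)) \<le> e * norm (w - z)"
    using der e unfolding has_derivative_at_alt by blast
  show ?thesis
  proof
    show "d / norm v > 0" using d v by simp
    fix t :: real assume t: "t \<noteq> 0" "\<bar>t\<bar> < d / norm v"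
    have "norm (t *\<^sub>R v) < d" using t v by (simp add: pos_less_divide_eq)
    then have "norm (f (z + t *\<^sub>R v) - f' (t *\<^sub>R v)) \<le> e * norm (t *\<^sub>R v)"
      using d(2)[of "z + t *\<^sub>R v"] assms(2) by simp
    also have "\<dots> = \<bar>t\<bar> * \<bar>f' v\<bar> / 2" unfolding e_def using v by simp
    finally have "norm (f (z + t *\<^sub>R v) - t * f' v) \<le> \<bar>t * f' v\<bar> / 2"
      by (simp add: linear_scale[OF lin] abs_mult)
    moreover have "\<bar>t * f' v\<bar> > 0" using t assms by simp
    ultimately show "f (z + t *\<^sub>R v) \<noteq> 0" by auto
  qed
qed

text \<open>Parameters chosen in infinitely many components would accumulate at some
  \<open>s\<close>. Zeros on the line are isolated, so chosen parameters close to \<open>s\<close>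
  and on the same side of it are joined by a segment without zeros and belong to the same
  component.\<close>

lemma finite_components_meeting_segment:
  fixes f :: "complex \<Rightarrow> real"
  assumes der: "\<And>z. (f has_derivative f' z) (at z)"
    and sub: "(\<lambda>t. z0 + t *\<^sub>R v) ` {\<alpha>..\<beta>} \<subseteq> K"
    and transversal: "\<And>t. \<lbrakk>t \<in> {\<alpha>..\<beta>}; f (z0 + t *\<^sub>R v) = 0\<rbrakk> \<Longrightarrow> f' (z0 + t *\<^sub>R v) v \<noteq> 0"
  shows "finite {W \<in> components ({z. f z \<noteq> 0} \<inter> K). W \<inter> (\<lambda>t. z0 + t *\<^sub>R v) ` {\<alpha>..\<beta>} \<noteq> {}}"
proof (rule ccontr)
  define l where "l t = z0 + t *\<^sub>R v" for t
  define \<W> where "\<W> = {W \<in> components ({z. f z \<noteq> 0} \<inter> K). W \<inter> l ` {\<alpha>..\<beta>} \<noteq> {}}"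
  assume "infinite {W \<in> components ({z. f z \<noteq> 0} \<inter> K). W \<inter> (\<lambda>t. z0 + t *\<^sub>R v) ` {\<alpha>..\<beta>} \<noteq> {}}"
  then have inf: "infinite \<W>" unfolding \<W>_def l_def .
  have "\<forall>W\<in>\<W>. \<exists>t. t \<in> {\<alpha>..\<beta>} \<and> l t \<in> W" unfolding \<W>_def by blast
  then obtain \<tau> where \<tau>: "\<And>W. W \<in> \<W> \<Longrightarrow> \<tau> W \<in> {\<alpha>..\<beta>} \<and> l (\<tau> W) \<in> W" by metis
  have eqW: "W = W'" if "W \<in> \<W>" "W' \<in> \<W>" "connected X" "X \<subseteq> {z. f z \<noteq> 0} \<inter> K" "W \<inter> X \<noteq> {}" "W' \<inter> X \<noteq> {}" for W W' X
  proof -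
    have W: "W \<in> components ({z. f z \<noteq> 0} \<inter> K)" "W' \<in> components ({z. f z \<noteq> 0} \<inter> K)"
      using that unfolding \<W>_def by auto
    have "X \<subseteq> W" using components_maximal[OF W(1) that(3,4,5)] .
    moreover have "X \<subseteq> W'" using components_maximal[OF W(2) that(3,4,6)] .
    ultimately have "W \<inter> W' \<noteq> {}" using that(5) by blast
    then show ?thesis using components_eq[OF W] by blast
  qed
  have inj: "inj_on \<tau> \<W>"
  proof (rule inj_onI)
    fix W W' assume "W \<in> \<W>" "W' \<in> \<W>" "\<tau> W = \<tau> W'"
    then show "W = W'"
      using \<tau>[of W] \<tau>[of W'] components_eq[of W _ W'] unfolding \<W>_def by auto
  qed
  then have "infinite (\<tau> ` \<W>)" "\<tau> ` \<W> \<subseteq> {\<alpha>..\<beta>}"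
    using inf finite_imageD \<tau> by blast+
  then obtain s where s: "s \<in> {\<alpha>..\<beta>}" "s islimpt (\<tau> ` \<W>)"
    using compact_eq_Bolzano_Weierstrass[of "{\<alpha>..\<beta>}"] by auto
  obtain d where d: "d > 0" "\<And>t. \<lbrakk>t \<noteq> s; \<bar>t - s\<bar> < d\<rbrakk> \<Longrightarrow> f (l t) \<noteq> 0"
  proof (cases "f (l s) = 0")
    case True
    then obtain d where d: "d > 0" "\<And>t. \<lbrakk>t \<noteq> 0; \<bar>t\<bar> < d\<rbrakk> \<Longrightarrow> f (l s + t *\<^sub>R v) \<noteq> 0"
      using isolated_zero_on_line[OF der[of "l s"] True, of v] transversal[OF s(1)] unfolding l_def by blast
    have "f (l t) \<noteq> 0" if "t \<noteq> s" "\<bar>t - s\<bar> < d" for t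
      using d(2)[of "t - s"] that unfolding l_def by (simp add: algebra_simps)
    then show ?thesis using d(1) that by blast
  next
    case False
    have "isCont f z" for z
      using der has_derivative_continuous by blast
    moreover have "isCont l s"
      unfolding l_def by (intro continuous_intros)
    ultimately have "isCont (\<lambda>t. f (l t)) s"
      using isCont_o2 by blast
    then obtain d where "d > 0" "\<And>t. dist t s < d \<Longrightarrow> dist (f (l t)) (f (l s)) < \<bar>f (l s)\<bar>"
      using False unfolding continuous_at_eps_delta by (metis zero_less_abs_iff)
    then show ?thesis using that by (fastforce simp: dist_real_def)
  qed
  have same_side: "t = t'" if tt: "t \<in> \<tau> ` \<W>" "t' \<in> \<tau> ` \<W>" and "\<bar>t - s\<bar> < d" "\<bar>t' - s\<bar> < d" "(t - s) * (t' - s) > 0" for t t'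
  proof -
    obtain W W' where W: "W \<in> \<W>" "W' \<in> \<W>" "t = \<tau> W" "t' = \<tau> W'" using tt by blast
    define X where "X = l ` {min t t'..max t t'}"
    have "f (l r) \<noteq> 0" if "r \<in> {min t t'..max t t'}" for r
      by (rule d(2)) (use that \<open>\<bar>t - s\<bar> < d\<close> \<open>\<bar>t' - s\<bar> < d\<close> \<open>(t - s) * (t' - s) > 0\<close> in \<open>auto simp: zero_less_mult_iff\<close>)
    moreover have "{min t t'..max t t'} \<subseteq> {\<alpha>..\<beta>}" using \<tau>[OF W(1)] \<tau>[OF W(2)] W by auto
    ultimately have "X \<subseteq> {z. f z \<noteq> 0} \<inter> K"
      using sub unfolding X_def l_def by blast
    moreover have "connected X"
      unfolding X_def l_def by (intro connected_continuous_image continuous_intros) auto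
    moreover have "l t \<in> W \<inter> X" "l t' \<in> W' \<inter> X"
      using \<tau>[OF W(1)] \<tau>[OF W(2)] W unfolding X_def by auto
    ultimately have "W = W'" using eqW W by blast
    then show ?thesis using W by simp
  qed
  have fin: "finite {t \<in> \<tau> ` \<W>. \<bar>t - s\<bar> < d \<and> (t - s) * c > 0}" (is "finite ?T") for c
  proof (cases "?T = {}")
    case True
    then show ?thesis by (metis finite.emptyI)
  next
    case False
    then obtain t0 where "t0 \<in> ?T" by blast
    then have "t = t0" if "t \<in> ?T" for t
      using same_side[of t t0] that by (auto simp: zero_less_mult_iff)
    then have "?T \<subseteq> {t0}" by blast
    then show ?thesis using finite_subset by blast
  qed
  have "\<tau> ` \<W> \<inter> ball s d \<subseteq> {s} \<union> {t \<in> \<tau> ` \<W>. \<bar>t - s\<bar> < d \<and> (t - s) * 1 > 0} \<union> {t \<in> \<tau> ` \<W>. \<bar>t - s\<bar> < d \<and> (t - s) * (-1) > 0}"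
    by (auto simp: dist_real_def)
  then have "finite (\<tau> ` \<W> \<inter> ball s d)"
    using fin finite_subset by (meson finite.emptyI finite.insertI finite_UnI)
  then show False
    using s(2) d(1) unfolding islimpt_eq_infinite_ball by blast
qed

text \<open>The sides of the box are placed on generic lines, so each side meets finitely many
  components. Every component reaches a side, since otherwise |f| would have a local
  maximum.\<close>

lemma ex_box_finite_components:
  fixes f :: "complex \<Rightarrow> real"
  assumes der: "\<And>z. (f has_derivative f' z) (at z)" and nz: "\<And>z. f' z \<noteq> (\<lambda>_. 0)" and "e > 0"
  obtains c d where "p \<in> box c d" "cbox c d \<subseteq> ball p e" "finite (components ({z. f z \<noteq> 0} \<inter> cbox c d))"
proof -
  define V where "V = Re ` {z. f z = 0 \<and> f' z \<i> = 0}"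
  define H where "H = Im ` {z. f z = 0 \<and> f' z 1 = 0}"
  have V: "negligible V" unfolding V_def using der nz by (rule negligible_Re_critical_zeros)
  have H: "negligible H"
  proof -
    \<comment> \<open>Rotation by \<open>\<i>\<close> turns horizontal lines into vertical ones, so
      \<open>H\<close> is covered by the corresponding set of real parts for the rotated
      function.\<close>
    have "((\<lambda>z. f (\<i> * z)) has_derivative (\<lambda>h. f' (\<i> * z) (\<i> * h))) (at z)" for z
      by (rule has_derivative_compose[OF _ der]) (auto intro!: derivative_eq_intros)
    moreover have "(\<lambda>h. f' (\<i> * z) (\<i> * h)) \<noteq> (\<lambda>_. 0)" for z
    proof
      assume "(\<lambda>h. f' (\<i> * z) (\<i> * h)) = (\<lambda>_. 0)"
      then have "f' (\<i> * z) (\<i> * (h / \<i>)) = 0" for h by meson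
      then show False using nz[of "\<i> * z"] by auto
    qed
    ultimately have "negligible (Re ` {z. f (\<i> * z) = 0 \<and> f' (\<i> * z) (\<i> * \<i>) = 0})"
      by (rule negligible_Re_critical_zeros)
    moreover have "H \<subseteq> Re ` {z. f (\<i> * z) = 0 \<and> f' (\<i> * z) (\<i> * \<i>) = 0}"
    proof
      fix y assume "y \<in> H"
      then obtain z where z: "f z = 0" "f' z 1 = 0" "y = Im z" unfolding H_def by blast
      have "f' z (-1) = 0"
        using linear_neg[OF has_derivative_linear[OF der[of z]], of 1] z by simp
      then have "z / \<i> \<in> {z. f (\<i> * z) = 0 \<and> f' (\<i> * z) (\<i> * \<i>) = 0}" "Re (z / \<i>) = y"
        using z by (auto simp: Re_divide)
      then show "y \<in> Re ` {z. f (\<i> * z) = 0 \<and> f' (\<i> * z) (\<i> * \<i>) = 0}" by blast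
    qed
    ultimately show ?thesis by (rule negligible_subset)
  qed
  have good: "\<exists>x. \<alpha> < x \<and> x < \<beta> \<and> x \<notin> N" if "negligible N" "\<alpha> < \<beta>" for N and \<alpha> \<beta> :: real
  proof -
    have "\<not> negligible {\<alpha><..<\<beta>}" using open_not_negligible[of "{\<alpha><..<\<beta>}"] that by auto
    then have "\<not> {\<alpha><..<\<beta>} \<subseteq> N" using that negligible_subset by blast
    then show ?thesis by auto
  qed
  obtain x1 where x1: "Re p - e/2 < x1" "x1 < Re p" "x1 \<notin> V" using good[OF V, of "Re p - e/2" "Re p"] \<open>e > 0\<close> by auto
  obtain x2 where x2: "Re p < x2" "x2 < Re p + e/2" "x2 \<notin> V" using good[OF V, of "Re p" "Re p + e/2"] \<open>e > 0\<close> by auto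
  obtain y1 where y1: "Im p - e/2 < y1" "y1 < Im p" "y1 \<notin> H" using good[OF H, of "Im p - e/2" "Im p"] \<open>e > 0\<close> by auto
  obtain y2 where y2: "Im p < y2" "y2 < Im p + e/2" "y2 \<notin> H" using good[OF H, of "Im p" "Im p + e/2"] \<open>e > 0\<close> by auto
  define c where "c = Complex x1 y1"
  define d where "d = Complex x2 y2"
  have cb: "z \<in> cbox c d \<longleftrightarrow> x1 \<le> Re z \<and> Re z \<le> x2 \<and> y1 \<le> Im z \<and> Im z \<le> y2" for z
    unfolding c_def d_def by (auto simp: in_cbox_complex_iff)
  have ob: "z \<in> box c d \<longleftrightarrow> x1 < Re z \<and> Re z < x2 \<and> y1 < Im z \<and> Im z < y2" for z
    unfolding c_def d_def by (auto simp: in_box_complex_iff)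
  show ?thesis
  proof
    show "p \<in> box c d" unfolding ob using x1 x2 y1 y2 by auto
    show "cbox c d \<subseteq> ball p e"
    proof
      fix z assume z: "z \<in> cbox c d"
      have "dist p z \<le> \<bar>Re z - Re p\<bar> + \<bar>Im z - Im p\<bar>"
        using cmod_le[of "z - p"] by (simp add: dist_norm norm_minus_commute)
      also have "\<dots> < e/2 + e/2"
      proof (rule add_strict_mono)
        show "\<bar>Re z - Re p\<bar> < e/2" using z x1 x2 unfolding cb abs_less_iff by argo
        show "\<bar>Im z - Im p\<bar> < e/2" using z y1 y2 unfolding cb abs_less_iff by argo
      qed
      finally show "z \<in> ball p e" by simp
    qed
    define vert where "vert x = (\<lambda>t. complex_of_real x + t *\<^sub>R \<i>) ` {y1..y2}" for x
    define hor where "hor y = (\<lambda>t. \<i> * complex_of_real y + t *\<^sub>R 1) ` {x1..x2}" for y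
    define CC where "CC A = {W \<in> components ({z. f z \<noteq> 0} \<inter> cbox c d). W \<inter> A \<noteq> {}}" for A
    have vert: "finite (CC (vert x))" if "x \<notin> V" "x1 \<le> x" "x \<le> x2" for x
      unfolding CC_def vert_def
    proof (rule finite_components_meeting_segment[OF der])
      show "(\<lambda>t. complex_of_real x + t *\<^sub>R \<i>) ` {y1..y2} \<subseteq> cbox c d"
        using that by (auto simp: cb)
      show "f' (complex_of_real x + t *\<^sub>R \<i>) \<i> \<noteq> 0" if "f (complex_of_real x + t *\<^sub>R \<i>) = 0" for t
      proof
        assume "f' (complex_of_real x + t *\<^sub>R \<i>) \<i> = 0"
        then have "Re (complex_of_real x + t *\<^sub>R \<i>) \<in> V" unfolding V_def using that by blast
        then show False using \<open>x \<notin> V\<close> by simp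
      qed
    qed
    have hor: "finite (CC (hor y))" if "y \<notin> H" "y1 \<le> y" "y \<le> y2" for y
      unfolding CC_def hor_def
    proof (rule finite_components_meeting_segment[OF der])
      show "(\<lambda>t. \<i> * complex_of_real y + t *\<^sub>R 1) ` {x1..x2} \<subseteq> cbox c d"
        using that by (auto simp: cb)
      show "f' (\<i> * complex_of_real y + t *\<^sub>R 1) 1 \<noteq> 0" if "f (\<i> * complex_of_real y + t *\<^sub>R 1) = 0" for t
      proof
        assume "f' (\<i> * complex_of_real y + t *\<^sub>R 1) 1 = 0"
        then have "Im (\<i> * complex_of_real y + t *\<^sub>R 1) \<in> H" unfolding H_def using that by blast
        then show False using \<open>y \<notin> H\<close> by simp
      qed
    qed
    have edge: "z \<in> vert x1 \<union> vert x2 \<union> hor y1 \<union> hor y2" if "z \<in> cbox c d - box c d" for z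
    proof -
      have *: "z = complex_of_real (Re z) + Im z *\<^sub>R \<i>" "z = \<i> * complex_of_real (Im z) + Re z *\<^sub>R 1"
        by (auto simp: complex_eq_iff)
      have "Re z = x1 \<or> Re z = x2 \<or> Im z = y1 \<or> Im z = y2" "Re z \<in> {x1..x2}" "Im z \<in> {y1..y2}"
        using that cb[of z] ob[of z] by auto
      then show ?thesis
        unfolding vert_def hor_def using * by (metis (lifting) UnI1 UnI2 image_eqI)
    qed
    have noext: "\<exists>w\<in>B. \<bar>f m\<bar> < \<bar>f w\<bar>" if "open B" "m \<in> B" "f m \<noteq> 0" for m B
    proof (rule ccontr)
      assume "\<not> ?thesis"
      then have "(\<forall>w\<in>B. f w \<le> f m) \<or> (\<forall>w\<in>B. f m \<le> f w)"
        using that by (cases "f m > 0") force+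
      then have "f' m = (\<lambda>_. 0)"
        using differential_zero_maxmin[OF that(2,1) der] by blast
      then show False using nz by blast
    qed
    \<comment> \<open>Let \<open>m\<close> maximize |f| on the closure of \<open>W\<close>. Since
      \<open>f m\<close> is not 0 and \<open>W\<close> is relatively closed, \<open>m\<close> lies
      in \<open>W\<close>, hence in the open box. A ball around \<open>m\<close> then stays in
      \<open>W\<close>, and \<open>noext\<close> applies.\<close>
    have meets: "W \<inter> (cbox c d - box c d) \<noteq> {}" if W: "W \<in> components ({z. f z \<noteq> 0} \<inter> cbox c d)" for W
    proof
      assume "W \<inter> (cbox c d - box c d) = {}"
      then have Wbox: "W \<subseteq> box c d" using in_components_subset[OF W] by blast
      have cW: "closure W \<subseteq> cbox c d"
        using in_components_subset[OF W] by (meson closed_cbox closure_minimal le_inf_iff)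
      have contf: "continuous_on UNIV f"
        using der has_derivative_continuous_on by blast
      have "compact (closure W)" using cW bounded_cbox bounded_subset by (metis closed_closure compact_eq_bounded_closed)
      then obtain m where m: "m \<in> closure W" "\<And>w. w \<in> closure W \<Longrightarrow> \<bar>f w\<bar> \<le> \<bar>f m\<bar>"
        using continuous_attains_sup[of "closure W" "\<lambda>z. \<bar>f z\<bar>"] in_components_nonempty[OF W]
          continuous_on_subset[OF contf] by (auto intro: continuous_intros)
      obtain w0 where "w0 \<in> W" "f w0 \<noteq> 0"
        using in_components_nonempty[OF W] in_components_subset[OF W] by blast
      then have fm: "f m \<noteq> 0" using m(2)[of w0] closure_subset by force
      obtain T where T: "closed T" "W = ({z. f z \<noteq> 0} \<inter> cbox c d) \<inter> T"
        using closedin_component[OF W] unfolding closedin_closed by blast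
      then have "m \<in> T" using m(1) closure_minimal[of W T] by blast
      then have "m \<in> W" using T(2) m(1) cW fm by blast
      define N where "N = box c d \<inter> {z. f z \<noteq> 0}"
      have N: "open N" unfolding N_def using contf by (intro open_Int open_box open_Collect_neq) auto
      moreover have "m \<in> N" unfolding N_def using Wbox \<open>m \<in> W\<close> fm by blast
      ultimately obtain r where r: "r > 0" "ball m r \<subseteq> N" by (meson open_contains_ball)
      have "ball m r \<subseteq> W"
      proof (rule components_maximal[OF W])
        show "W \<inter> ball m r \<noteq> {}" using \<open>m \<in> W\<close> r(1) by auto
        show "ball m r \<subseteq> {z. f z \<noteq> 0} \<inter> cbox c d" using r(2) box_subset_cbox[of c d] unfolding N_def by blast
      qed simp
      then show False
        using noext[of "ball m r" m] m(2) fm r(1) closure_subset[of W] by force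
    qed
    have "components ({z. f z \<noteq> 0} \<inter> cbox c d) \<subseteq> CC (vert x1) \<union> CC (vert x2) \<union> CC (hor y1) \<union> CC (hor y2)"
    proof
      fix W assume W: "W \<in> components ({z. f z \<noteq> 0} \<inter> cbox c d)"
      then obtain z where "z \<in> W" "z \<in> cbox c d - box c d" using meets by blast
      then show "W \<in> CC (vert x1) \<union> CC (vert x2) \<union> CC (hor y1) \<union> CC (hor y2)"
        using W edge[of z] unfolding CC_def by blast
    qed
    moreover have "finite (CC (vert x1) \<union> CC (vert x2) \<union> CC (hor y1) \<union> CC (hor y2))"
      using vert[of x1] vert[of x2] hor[of y1] hor[of y2] x1 x2 y1 y2 by simp
    ultimately show "finite (components ({z. f z \<noteq> 0} \<inter> cbox c d))"
      by (rule finite_subset)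
  qed
qed

section \<open>Accessibility of frontier points\<close>

lemma path_infinite_join:
  fixes P :: "nat \<Rightarrow> real \<Rightarrow> 'a::metric_space"
  assumes path: "\<And>n. path (P n)" and join: "\<And>n. pathfinish (P n) = pathstart (P (Suc n))"
    and lim: "\<And>e. e > 0 \<Longrightarrow> \<exists>N. \<forall>n\<ge>N. path_image (P n) \<subseteq> ball p e"
  obtains g where "path g" "pathstart g = pathstart (P 0)" "pathfinish g = p"
    "path_image g \<subseteq> insert p (\<Union>n. path_image (P n))"
proof -
  \<comment> \<open>\<open>G\<close> runs through \<open>P n\<close> between the times
    \<open>n\<close> and \<open>n + 1\<close>. Below, \<open>g\<close> compresses the half-line to
    \<open>[0, 1)\<close> by \<open>s / (1 - s)\<close>, and \<open>lim\<close> gives continuity at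
    1.\<close>
  define G where "G t = P (nat \<lfloor>t\<rfloor>) (t - of_int \<lfloor>t\<rfloor>)" for t
  have G_eq: "G t = P n (t - real n)" if "t \<in> {real n..real (Suc n)}" for n t
  proof (cases "t = real (Suc n)")
    case True
    then have "\<lfloor>t\<rfloor> = int (Suc n)" "nat \<lfloor>t\<rfloor> = Suc n" by linarith+
    then show ?thesis
      using join[of n] True unfolding G_def pathstart_def pathfinish_def by simp
  next
    case False
    then have "\<lfloor>t\<rfloor> = int n" using that by (simp add: floor_eq_iff)
    then show ?thesis unfolding G_def by simp
  qed
  have G_mem: "G t \<in> path_image (P (nat \<lfloor>t\<rfloor>))" if "t \<ge> 0" for t
  proof -
    have "0 \<le> t - of_int \<lfloor>t\<rfloor>" "t - of_int \<lfloor>t\<rfloor> \<le> 1" by linarith+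
    then show ?thesis unfolding G_def path_image_def by simp
  qed
  have piece: "continuous_on {real n..real (Suc n)} G" for n
  proof -
    have "continuous_on {real n..real (Suc n)} (\<lambda>t. P n (t - real n))"
      by (rule continuous_on_compose2[OF path[unfolded path_def]]) (auto intro!: continuous_intros)
    then show ?thesis by (subst continuous_on_cong[OF refl G_eq]) auto
  qed
  have upto: "continuous_on {0..real n} G" for n
  proof (induction n)
    case (Suc n)
    have "{0..real (Suc n)} = {0..real n} \<union> {real n..real (Suc n)}" by auto
    then show ?case using continuous_on_closed_Un[OF _ _ Suc piece[of n]] by simp
  qed simp
  define g where "g s = (if s < 1 then G (s / (1 - s)) else p)" for s
  have "path g"
    unfolding path_def continuous_on_eq_continuous_within
  proof
    fix s :: real assume s: "s \<in> {0..1}"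
    show "continuous (at s within {0..1}) g"
    proof (cases "s < 1")
      case True
      define r where "r = (s + 1) / 2"
      have r: "s < r" "r < 1" "0 < r" using True s unfolding r_def by auto
      obtain n where n: "r / (1 - r) \<le> real n" using real_arch_simple by blast
      have "continuous_on {0..r} (\<lambda>s. G (s / (1 - s)))"
      proof (rule continuous_on_compose2[OF upto[of n]])
        show "continuous_on {0..r} (\<lambda>s. s / (1 - s))" using r by (intro continuous_intros) auto
        have "x / (1 - x) \<le> real n" if "0 \<le> x" "x \<le> r" for x
        proof -
          have "x / (1 - x) \<le> r / (1 - r)" using that r by (intro frac_le) auto
          then show ?thesis using n by linarith
        qed
        then show "(\<lambda>s. s / (1 - s)) ` {0..r} \<subseteq> {0..real n}" using r by auto
      qed
      then have "continuous_on {0..r} g"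
        by (subst continuous_on_cong[OF refl]) (use r in \<open>auto simp: g_def\<close>)
      then have "continuous (at s within {0..r}) g"
        using r s by (simp add: continuous_on_eq_continuous_within)
      moreover have "at s within {0..r} = at s within {0..1}"
        by (rule at_within_nhd[of _ "{..<r}"]) (use r in auto)
      ultimately show ?thesis by simp
    next
      case False
      then have s1: "s = 1" using s by simp
      show ?thesis
        unfolding continuous_within_eps_delta
      proof (intro allI impI)
        fix e :: real assume "e > 0"
        then obtain N where N: "\<And>n. n \<ge> N \<Longrightarrow> path_image (P n) \<subseteq> ball p e" using lim by blast
        define d where "d = 1 / (real N + 1)"
        have d: "d > 0" unfolding d_def by simp
        have "dist (g x) (g s) < e" if x: "x \<in> {0..1}" "dist x s < d" for x
        proof (cases "x < 1")
          case True
          have "1 - x < 1 / (real N + 1)" using x s1 True unfolding d_def by (simp add: dist_real_def)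
          then have "(1 - x) * (real N + 1) < 1" by (simp add: pos_less_divide_eq)
          then have "real N * (1 - x) \<le> x" by (simp add: algebra_simps)
          then have "real N \<le> x / (1 - x)" using True by (simp add: pos_le_divide_eq)
          then have "N \<le> nat \<lfloor>x / (1 - x)\<rfloor>" by (simp add: le_nat_floor)
          moreover have "g x \<in> path_image (P (nat \<lfloor>x / (1 - x)\<rfloor>))"
            unfolding g_def using True x G_mem[of "x / (1 - x)"] by simp
          ultimately have "g x \<in> ball p e" using N by blast
          then show ?thesis unfolding s1 g_def by (simp add: dist_commute)
        next
          case False
          then show ?thesis using \<open>e > 0\<close> unfolding s1 g_def by simp
        qed
        then show "\<exists>d>0. \<forall>x\<in>{0..1}. dist x s < d \<longrightarrow> dist (g x) (g s) < e" using d by blast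
      qed
    qed
  qed
  moreover have "pathstart g = pathstart (P 0)" "pathfinish g = p"
    using G_eq[of 0 0] unfolding pathstart_def pathfinish_def g_def by auto
  moreover have "path_image g \<subseteq> insert p (\<Union>n. path_image (P n))"
  proof
    fix x assume "x \<in> path_image g"
    then obtain s where s: "s \<in> {0..1}" "x = g s" unfolding path_image_def by blast
    show "x \<in> insert p (\<Union>n. path_image (P n))"
      using G_mem[of "s / (1 - s)"] s unfolding g_def by auto
  qed
  ultimately show ?thesis using that by blast
qed

text \<open>\<open>A \<inter> K\<close> is open in a convex set and hence locally path connected,
  even if \<open>K\<close> is a closed box. So its components are path components.\<close>

lemma path_connected_component_open_Int_convex:
  fixes K :: "'a::real_normed_vector set"
  assumes "open A" "convex K" "W \<in> components (A \<inter> K)"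
  shows "path_connected W"
proof -
  have "locally path_connected (A \<inter> K)"
    using locally_open_subset[OF convex_imp_locally_path_connected[OF assms(2)]] openin_open_Int[OF assms(1), of K]
    by (simp add: Int_commute)
  then obtain x where "W = path_component_set (A \<inter> K) x"
    using assms(3) path_component_eq_connected_component_set unfolding components_def by blast
  then show ?thesis by (metis path_connected_path_component)
qed

text \<open>All that is used of a differentiable function without critical points.\<close>

locale regular_function =
  fixes f :: "complex \<Rightarrow> real"
  assumes cont: "continuous_on UNIV f"
    and ex_greater: "e > 0 \<Longrightarrow> \<exists>w\<in>ball z e. f z < f w"
    and ex_less: "e > 0 \<Longrightarrow> \<exists>w\<in>ball z e. f w < f z"
    and ex_box: "e > 0 \<Longrightarrow> \<exists>c d. p \<in> box c d \<and> cbox c d \<subseteq> ball p e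
                    \<and> finite (components ({z. f z \<noteq> 0} \<inter> cbox c d))"
begin

lemma open_nonzero: "open {z. f z \<noteq> 0}"
  using cont by (intro open_Collect_neq) auto

lemma ex_nonzero:
  assumes "open X" "X \<noteq> {}"
  obtains w where "w \<in> X" "f w \<noteq> 0"
proof -
  obtain z e where "z \<in> X" "e > 0" "ball z e \<subseteq> X" using assms open_contains_ball by blast
  moreover obtain w where "w \<in> ball z e" "f z < f w" using ex_greater[OF \<open>e > 0\<close>] by blast
  ultimately have "(z \<in> X \<and> f z \<noteq> 0) \<or> (w \<in> X \<and> f w \<noteq> 0)" by auto
  then show ?thesis using that by blast
qed

lemma subset_if_frontier_zero:
  assumes "connected W" "W \<subseteq> {z. f z \<noteq> 0}" "W \<inter> X \<noteq> {}" "frontier X \<inter> W \<subseteq> {z. f z = 0}"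
  shows "W \<subseteq> X"
  using connected_Int_frontier[OF assms(1,3)] assms(2,4) by blast

text \<open>On a compact closure \<open>f\<close> would attain its extrema, but not in the open set
  \<open>X\<close>. Both would lie on the frontier and equal 0, so \<open>f\<close> would vanish on
  \<open>X\<close>, contrary to \<open>ex_nonzero\<close>.\<close>

lemma unbounded_if_frontier_zero:
  assumes "open X" "X \<noteq> {}" "frontier X \<subseteq> {z. f z = 0}"
  shows "\<not> bounded X"
proof
  assume "bounded X"
  then have cX: "compact (closure X)" by simp
  obtain w where w: "w \<in> X" "f w \<noteq> 0" using ex_nonzero assms by blast
  have clX: "closure X = X \<union> frontier X" using closure_Un_frontier by blast
  have cf: "continuous_on (closure X) f" using cont continuous_on_subset by blast
  have ne: "closure X \<noteq> {}" using assms(2) by simp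
  obtain M where M: "M \<in> closure X" "\<And>z. z \<in> closure X \<Longrightarrow> f z \<le> f M"
    using continuous_attains_sup[OF cX ne cf] by blast
  obtain m where m: "m \<in> closure X" "\<And>z. z \<in> closure X \<Longrightarrow> f m \<le> f z"
    using continuous_attains_inf[OF cX ne cf] by blast
  have "M \<notin> X"
  proof
    assume "M \<in> X"
    then obtain e where "e > 0" "ball M e \<subseteq> X" using assms(1) open_contains_ball by blast
    then show False using ex_greater[of e M] M(2) clX by fastforce
  qed
  moreover have "m \<notin> X"
  proof
    assume "m \<in> X"
    then obtain e where "e > 0" "ball m e \<subseteq> X" using assms(1) open_contains_ball by blast
    then show False using ex_less[of e m] m(2) clX by fastforce
  qed
  ultimately have "f M = 0" "f m = 0" using M(1) m(1) clX assms(3) by blast+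
  then show False using M(2)[of w] m(2)[of w] w clX by simp
qed

text \<open>Only finitely many components in the box meet \<open>X\<close>, so the closure of their
  union is the union of their closures, and one of these contains \<open>p\<close>.\<close>

lemma ex_box_component:
  assumes "p \<in> closure X" "X \<subseteq> {z. f z \<noteq> 0}" "e > 0"
  obtains c d W where "p \<in> box c d" "cbox c d \<subseteq> ball p e" "W \<in> components ({z. f z \<noteq> 0} \<inter> cbox c d)"
    "W \<inter> X \<noteq> {}" "p \<in> closure W"
proof -
  obtain c d where cd: "p \<in> box c d" "cbox c d \<subseteq> ball p e" "finite (components ({z. f z \<noteq> 0} \<inter> cbox c d))"
    using ex_box[OF \<open>e > 0\<close>] by blast
  define \<W> where "\<W> = {W \<in> components ({z. f z \<noteq> 0} \<inter> cbox c d). W \<inter> X \<noteq> {}}"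
  have fin: "finite \<W>" unfolding \<W>_def using cd(3) by simp
  have "X \<inter> cbox c d \<subseteq> \<Union>\<W>"
  proof
    fix x assume x: "x \<in> X \<inter> cbox c d"
    then have "x \<in> \<Union>(components ({z. f z \<noteq> 0} \<inter> cbox c d))"
      using assms(2) Union_components[of "{z. f z \<noteq> 0} \<inter> cbox c d"] by blast
    then show "x \<in> \<Union>\<W>" using x unfolding \<W>_def by blast
  qed
  moreover have "p \<in> closure (X \<inter> cbox c d)"
  proof -
    have "p \<in> closure (box c d \<inter> X)"
      using open_Int_closure_subset[OF open_box, of c d X] cd(1) assms(1) by blast
    moreover have "box c d \<inter> X \<subseteq> X \<inter> cbox c d" using box_subset_cbox[of c d] by blast
    ultimately show ?thesis using closure_mono by blast
  qed
  ultimately have "p \<in> closure (\<Union>\<W>)" using closure_mono by blast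
  moreover have "closure (\<Union>\<W>) \<subseteq> \<Union>(closure ` \<W>)"
    using fin closure_subset by (intro closure_minimal closed_Union) (auto simp: Union_mono)
  ultimately obtain W where "W \<in> \<W>" "p \<in> closure W" by blast
  then show ?thesis using that cd unfolding \<W>_def by blast
qed

text \<open>In shrinking boxes around \<open>p\<close> one chooses nested path connected components
  \<open>W n\<close> of the nonzero set, each with \<open>p\<close> in its closure. Paths inside the
  \<open>W n\<close>, strung together, end at \<open>p\<close>. The first component stays in
  \<open>X\<close> because its box lies where the frontier of \<open>X\<close> consists of
  zeros.\<close>

theorem accessible:
  assumes "open X" "p \<in> frontier X" "e > 0" and zero: "frontier X \<inter> ball p e \<subseteq> {z. f z = 0}"
  obtains g where "path g" "pathfinish g = p" "pathstart g \<in> X" "path_image g - {p} \<subseteq> X \<inter> {z. f z \<noteq> 0}"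
proof -
  define S where "S = {z. f z \<noteq> 0}"
  define Good where "Good n T \<longleftrightarrow> (case T of (c, d, W) \<Rightarrow> p \<in> box c d \<and> cbox c d \<subseteq> ball p (1 / real (Suc n))
      \<and> W \<in> components (S \<inter> cbox c d) \<and> W \<subseteq> X \<and> p \<in> closure W)" for n and T :: "complex \<times> complex \<times> complex set"
  have "\<exists>T. \<forall>n. Good n (T n) \<and> snd (snd (T (Suc n))) \<subseteq> snd (snd (T n))"
  proof (rule dependent_nat_choice)
    have "p \<in> closure (X \<inter> S)"
      unfolding closure_approachable
    proof (intro allI impI)
      fix r :: real assume "r > 0"
      then have "X \<inter> ball p r \<noteq> {}"
        using assms(2) closure_approachable[of p X] \<open>r > 0\<close> unfolding frontier_def
        by (metis DiffD1 dist_commute disjoint_iff mem_ball)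
      then obtain w where "w \<in> X \<inter> ball p r" "f w \<noteq> 0"
        using ex_nonzero[of "X \<inter> ball p r"] assms(1) by blast
      then show "\<exists>y\<in>X \<inter> S. dist y p < r" unfolding S_def by (auto simp: dist_commute)
    qed

    moreover have "X \<inter> S \<subseteq> S" "min e 1 > 0" using \<open>e > 0\<close> by auto
    ultimately obtain c d W where W: "p \<in> box c d" "cbox c d \<subseteq> ball p (min e 1)" "W \<in> components (S \<inter> cbox c d)"
        "W \<inter> (X \<inter> S) \<noteq> {}" "p \<in> closure W"
      by (rule ex_box_component[folded S_def])
    have "W \<subseteq> S" "W \<subseteq> ball p e" using in_components_subset[OF W(3)] W(2) by auto
    then have "W \<subseteq> X"
      using subset_if_frontier_zero[OF in_components_connected[OF W(3)]] W(4) zero unfolding S_def by blast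
    then show "\<exists>T. Good 0 T" using W unfolding Good_def by (intro exI[of _ "(c, d, W)"]) auto
  next
    fix T n assume "Good n T"
    then obtain c d W where T: "T = (c, d, W)" "p \<in> box c d" "W \<in> components (S \<inter> cbox c d)" "W \<subseteq> X" "p \<in> closure W"
      unfolding Good_def by (cases T) auto
    \<comment> \<open>The next box is taken inside the present one, so that a component meeting
      \<open>W\<close> is contained in \<open>W\<close>.\<close>
    obtain r where r: "r > 0" "ball p r \<subseteq> box c d" using T(2) open_box open_contains_ball by blast
    have "W \<subseteq> S" "min r (1 / real (Suc (Suc n))) > 0" using r(1) in_components_subset[OF T(3)] by auto
    with T(5) obtain c' d' W' where W': "p \<in> box c' d'" "cbox c' d' \<subseteq> ball p (min r (1 / real (Suc (Suc n))))"
        "W' \<in> components (S \<inter> cbox c' d')" "W' \<inter> W \<noteq> {}" "p \<in> closure W'"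
      by (rule ex_box_component[folded S_def])
    have "W' \<subseteq> S \<inter> cbox c d"
    proof -
      have "ball p (min r (1 / real (Suc (Suc n)))) \<subseteq> ball p r" by (rule subset_ball) simp
      then show ?thesis
        using in_components_subset[OF W'(3)] W'(2) r(2) box_subset_cbox[of c d] by blast
    qed
    then have "W' \<subseteq> W"
      using components_maximal[OF T(3) in_components_connected[OF W'(3)]] W'(4) by blast
    then show "\<exists>T'. Good (Suc n) T' \<and> snd (snd T') \<subseteq> snd (snd T)"
      using W' T unfolding Good_def by (intro exI[of _ "(c', d', W')"]) auto
  qed
  then obtain T where T: "\<And>n. Good n (T n)" "\<And>n. snd (snd (T (Suc n))) \<subseteq> snd (snd (T n))" by blast
  define W where "W n = snd (snd (T n))" for n
  have W: "W n \<noteq> {}" "path_connected (W n)" "W n \<subseteq> X \<inter> S" "W n \<subseteq> ball p (1 / real (Suc n))" "W (Suc n) \<subseteq> W n" for n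
  proof -
    obtain c d where cd: "cbox c d \<subseteq> ball p (1 / real (Suc n))" "W n \<in> components (S \<inter> cbox c d)" "W n \<subseteq> X"
      using T(1)[of n] unfolding Good_def W_def by (cases "T n") auto
    show "path_connected (W n)"
      using path_connected_component_open_Int_convex[OF _ convex_box(1) cd(2)] open_nonzero unfolding S_def by blast
    show "W n \<noteq> {}" using in_components_nonempty[OF cd(2)] .
    show "W n \<subseteq> X \<inter> S" "W n \<subseteq> ball p (1 / real (Suc n))" using in_components_subset[OF cd(2)] cd by blast+
    show "W (Suc n) \<subseteq> W n" using T(2) unfolding W_def .
  qed
  have "\<forall>n. \<exists>x. x \<in> W n" using W(1) by auto
  then obtain x where x: "\<And>n. x n \<in> W n" by metis
  have "\<exists>g. path g \<and> path_image g \<subseteq> W n \<and> pathstart g = x n \<and> pathfinish g = x (Suc n)" for n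
    using W(2)[of n] W(5)[of n] x[of n] x[of "Suc n"] unfolding path_connected_def by blast
  then obtain P where P: "\<And>n. path (P n)" "\<And>n. path_image (P n) \<subseteq> W n" "\<And>n. pathstart (P n) = x n" "\<And>n. pathfinish (P n) = x (Suc n)"
    by metis
  have lim: "\<exists>N. \<forall>n\<ge>N. path_image (P n) \<subseteq> ball p e" if e0: "e > 0" for e
  proof -
    obtain N where N: "1 / real (Suc N) < e" using nat_approx_posE[OF e0] by blast
    have "path_image (P n) \<subseteq> ball p e" if "n \<ge> N" for n
    proof -
      have "1 / real (Suc n) \<le> 1 / real (Suc N)" using that by (simp add: frac_le)
      then have "ball p (1 / real (Suc n)) \<subseteq> ball p e" using N by (intro subset_ball) simp
      then show ?thesis using P(2)[of n] W(4)[of n] by blast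
    qed
    then show ?thesis by blast
  qed
  obtain g where g: "path g" "pathstart g = pathstart (P 0)" "pathfinish g = p" "path_image g \<subseteq> insert p (\<Union>n. path_image (P n))"
    using path_infinite_join[of P p] P lim by auto
  have "path_image g - {p} \<subseteq> X \<inter> {z. f z \<noteq> 0}"
    using g(4) P(2) W(3) unfolding S_def by blast
  moreover have "pathstart g \<in> X" using g(2) P(3) x[of 0] W(3)[of 0] by auto
  ultimately show ?thesis using that g by blast
qed

end

section \<open>The part of a common frontier inside a Jordan curve\<close>

definition accessible_from :: "'a::real_normed_vector set \<Rightarrow> 'a \<Rightarrow> bool" where
  "accessible_from X p \<longleftrightarrow> (\<exists>g. path g \<and> pathstart g \<in> X \<and> pathfinish g = p \<and> path_image g - {p} \<subseteq> X)"

section \<open>Arcs ending at accessible points\<close>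

lemma accessible_path:
  fixes X :: "'a::euclidean_space set"
  assumes "open X" "connected X" "accessible_from X p" "x \<in> X"
  obtains g where "path g" "pathstart g = p" "pathfinish g = x" "path_image g \<subseteq> insert p X"
proof -
  obtain g where g: "path g" "pathstart g \<in> X" "pathfinish g = p" "path_image g - {p} \<subseteq> X"
    using assms(3) unfolding accessible_from_def by blast
  have "path_connected X" using assms(1,2) connected_open_path_connected by blast
  then obtain h where h: "path h" "path_image h \<subseteq> X" "pathstart h = pathstart g" "pathfinish h = x"
    using g(2) assms(4) unfolding path_connected_def by blast
  show ?thesis
  proof
    show "path (reversepath g +++ h)" using g h by simp
    show "path_image (reversepath g +++ h) \<subseteq> insert p X"
      using path_image_join_subset[of "reversepath g" h] g h by auto
  qed (use g h in auto)
qed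

lemma accessible_arc_between:
  fixes X :: "'a::euclidean_space set"
  assumes "open X" "connected X" "accessible_from X p" "accessible_from X q" "p \<noteq> q"
  obtains g where "arc g" "pathstart g = p" "pathfinish g = q" "path_image g - {p, q} \<subseteq> X"
proof -
  obtain x where x: "x \<in> X" using assms(3) unfolding accessible_from_def by blast
  obtain g where g: "path g" "pathstart g = p" "pathfinish g = x" "path_image g \<subseteq> insert p X"
    using accessible_path[OF assms(1-3) x] by blast
  obtain h where h: "path h" "pathstart h = q" "pathfinish h = x" "path_image h \<subseteq> insert q X"
    using accessible_path[OF assms(1,2,4) x] by blast
  have 1: "path (g +++ reversepath h)" "pathstart (g +++ reversepath h) = p" "pathfinish (g +++ reversepath h) = q"
    using g h by auto
  obtain k where "arc k" "path_image k \<subseteq> path_image (g +++ reversepath h)" "pathstart k = p" "pathfinish k = q"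
    using path_contains_arc[OF 1 assms(5)] by blast
  then show ?thesis
    using that[of k] path_image_join_subset[of g "reversepath h"] g h by auto
qed

text \<open>One half of a crosscut: a path from \<open>p\<close> through \<open>X\<close> is stopped
  where it first leaves \<open>I\<close> and then thinned to an arc.\<close>

lemma accessible_arc_to_frontier:
  fixes X :: "'a::euclidean_space set"
  assumes "open X" "connected X" "accessible_from X p" "open I" "p \<in> I" "p \<notin> X" "x \<in> X" "x \<notin> I"
  obtains g where "arc g" "pathstart g = p" "pathfinish g \<in> frontier I \<inter> X"
    "path_image g - {p, pathfinish g} \<subseteq> X" "path_image g - {pathfinish g} \<subseteq> I"
proof -
  obtain g where g: "path g" "pathstart g = p" "pathfinish g = x" "path_image g \<subseteq> insert p X"
    using accessible_path[OF assms(1-3,7)] by blast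
  have "pathstart g \<in> closure I" "pathfinish g \<notin> I"
    using g assms closure_subset by auto
  then obtain h where h: "path h" "pathstart h = pathstart g" "path_image h \<subseteq> path_image g"
      "path_image h - {pathfinish h} \<subseteq> interior I" "pathfinish h \<in> frontier I"
    using exists_path_subpath_to_frontier[OF g(1)] by blast
  have ne: "pathfinish h \<noteq> p"
    using h(5) assms(4,5) by (auto simp: frontier_def interior_open)
  obtain k where k: "arc k" "path_image k \<subseteq> path_image h" "pathstart k = p" "pathfinish k = pathfinish h"
    using path_contains_arc[OF h(1) _ refl, of p] h(2) g(2) ne by auto
  show ?thesis
  proof
    show "pathfinish k \<in> frontier I \<inter> X"
      using k(4) h(3,5) g(4) ne pathfinish_in_path_image[of h] by auto
    show "path_image k - {p, pathfinish k} \<subseteq> X"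
      using k h(3) g(4) by auto
    show "path_image k - {pathfinish k} \<subseteq> I"
      using k h(4) interior_subset[of I] by auto
  qed (use k in auto)
qed

lemma arc_split:
  fixes g :: "real \<Rightarrow> 'a::real_normed_vector"
  assumes "arc g" "x \<in> path_image g" "x \<noteq> pathstart g" "x \<noteq> pathfinish g"
  obtains u v where "arc u" "arc v" "pathstart u = pathstart g" "pathfinish u = x" "pathstart v = x"
    "pathfinish v = pathfinish g" "path_image u \<union> path_image v = path_image g" "path_image u \<inter> path_image v = {x}"
proof -
  obtain t where t: "t \<in> {0..1}" "g t = x" using assms(2) unfolding path_image_def by blast
  have t01: "0 < t" "t < 1"
    using t assms(3,4) unfolding pathstart_def pathfinish_def by (auto simp: less_le)
  have inj: "inj_on g {0..1}" using assms(1) arc_def by blast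
  show ?thesis
  proof
    show "arc (subpath 0 t g)" "arc (subpath t 1 g)"
      using arc_subpath_arc[OF assms(1)] t01 by auto
    show "path_image (subpath 0 t g) \<union> path_image (subpath t 1 g) = path_image g"
    proof -
      have "{0..t} \<union> {t..1} = {0..1}" using t01 by auto
      then have "g ` {0..t} \<union> g ` {t..1} = path_image g" unfolding path_image_def by (metis image_Un)
      then show ?thesis using t01 by (simp add: path_image_subpath)
    qed
    show "path_image (subpath 0 t g) \<inter> path_image (subpath t 1 g) = {x}"
    proof -
      have "g ` {0..t} \<inter> g ` {t..1} = g ` ({0..t} \<inter> {t..1})"
        using inj_on_image_Int[OF inj, of "{0..t}" "{t..1}"] t01 by auto
      moreover have "{0..t} \<inter> {t..1} = {t}" using t01 by auto
      ultimately show ?thesis using t01 t(2) by (simp add: path_image_subpath)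
    qed
  qed (use t in \<open>auto simp: pathstart_def pathfinish_def subpath_def\<close>)
qed

lemma connected_arc_minus_start:
  assumes "arc g"
  shows "connected (path_image g - {pathstart g})"
proof -
  have "inj_on g {0..1}" "continuous_on {0..1} g" using assms unfolding arc_def path_def by auto
  then have "path_image g - {pathstart g} = g ` {0<..1}"
    unfolding path_image_def pathstart_def by (auto simp: inj_on_def less_le)
  moreover have "connected (g ` {0<..1})"
    by (rule connected_continuous_image) (use \<open>continuous_on {0..1} g\<close> in \<open>auto elim: continuous_on_subset\<close>)
  ultimately show ?thesis by simp
qed

lemma connected_arc_minus_finish:
  assumes "arc g"
  shows "connected (path_image g - {pathfinish g})"
  using connected_arc_minus_start[of "reversepath g"] assms by (simp add: arc_reversepath)

lemma arc_ex_inner_point: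
  assumes "arc g"
  obtains x where "x \<in> path_image g - {pathstart g, pathfinish g}"
proof -
  have inj: "inj_on g {0..1}" using assms arc_def by blast
  have "g (1/2) \<noteq> g 0" "g (1/2) \<noteq> g 1"
    using inj_onD[OF inj, of "1/2" 0] inj_onD[OF inj, of "1/2" 1] by auto
  moreover have "g (1/2) \<in> path_image g" unfolding path_image_def by auto
  ultimately show ?thesis using that[of "g (1/2)"] unfolding pathstart_def pathfinish_def by blast
qed

text \<open>The Jordan curve is kept as two arcs because in each use these run, apart from their
  ends, through two disjoint open sets.\<close>

locale two_arcs =
  fixes \<alpha> \<beta> :: "real \<Rightarrow> complex" and a b :: complex
  assumes arc: "arc \<alpha>" "arc \<beta>" and ends: "pathstart \<alpha> = a" "pathfinish \<alpha> = b" "pathstart \<beta> = a" "pathfinish \<beta> = b"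
    and Int: "path_image \<alpha> \<inter> path_image \<beta> = {a, b}"
begin

definition "J = path_image \<alpha> \<union> path_image \<beta>"

lemma ab: "a \<noteq> b" "a \<in> path_image \<alpha>" "b \<in> path_image \<alpha>" "a \<in> path_image \<beta>" "b \<in> path_image \<beta>"
  using arc ends Int arc_distinct_ends[of \<alpha>] by auto

lemma loop: "simple_path (\<alpha> +++ reversepath \<beta>)" "pathfinish (\<alpha> +++ reversepath \<beta>) = pathstart (\<alpha> +++ reversepath \<beta>)"
  "path_image (\<alpha> +++ reversepath \<beta>) = J"
  using arc ends Int by (auto simp: simple_path_join_loop_eq arc_reversepath path_image_join J_def)

lemma Jordan:
  "inside J \<noteq> {}" "open (inside J)" "connected (inside J)" "outside J \<noteq> {}" "open (outside J)" "connected (outside J)"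
  "bounded (inside J)" "\<not> bounded (outside J)" "inside J \<inter> outside J = {}" "inside J \<union> outside J = - J"
  "frontier (inside J) = J" "frontier (outside J) = J"
  using Jordan_inside_outside[OF loop(1,2)] unfolding loop(3) by blast+

lemma connected_J_minus: "connected (J - {a})" "connected (J - {b})"
proof -
  have "J - {a} = (path_image \<alpha> - {a}) \<union> (path_image \<beta> - {a})" "J - {b} = (path_image \<alpha> - {b}) \<union> (path_image \<beta> - {b})"
    unfolding J_def by auto
  then show "connected (J - {a})" "connected (J - {b})"
    using connected_arc_minus_start[OF arc(1)] connected_arc_minus_start[OF arc(2)]
      connected_arc_minus_finish[OF arc(1)] connected_arc_minus_finish[OF arc(2)] ab
    unfolding ends by (auto intro!: connected_Un)
qed

text \<open>\<open>J\<close> and \<open>c\<close> form a theta curve, so \<open>c\<close> divides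
  the inside of \<open>J\<close> into two Jordan domains. With their boundary curves added they give
  \<open>A\<close> and \<open>B\<close>.\<close>

lemma crosscut_separates:
  assumes c: "arc c" "pathstart c \<in> path_image \<alpha> - {a, b}" "pathfinish c \<in> path_image \<beta> - {a, b}"
    and sub: "path_image c - {pathstart c, pathfinish c} \<subseteq> inside J" and ne: "path_image c \<inter> inside J \<noteq> {}"
  obtains A B where "closed A" "closed B" "inside J \<subseteq> A \<union> B" "A \<inter> B = path_image c" "a \<in> A" "b \<in> B"
proof -
  let ?x = "pathstart c" and ?y = "pathfinish c"
  obtain u1 v1 where 1: "arc u1" "arc v1" "pathstart u1 = a" "pathfinish u1 = ?x" "pathstart v1 = ?x"
    "pathfinish v1 = b" "path_image u1 \<union> path_image v1 = path_image \<alpha>" "path_image u1 \<inter> path_image v1 = {?x}"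
    using arc_split[OF arc(1), of ?x] c(2) unfolding ends by blast
  obtain u2 v2 where 2: "arc u2" "arc v2" "pathstart u2 = a" "pathfinish u2 = ?y" "pathstart v2 = ?y"
    "pathfinish v2 = b" "path_image u2 \<union> path_image v2 = path_image \<beta>" "path_image u2 \<inter> path_image v2 = {?y}"
    using arc_split[OF arc(2), of ?y] c(3) unfolding ends by blast
  have ne_ab: "?x \<noteq> a" "?x \<noteq> b" "?y \<noteq> a" "?y \<noteq> b" using c(2,3) by auto
  have a1: "a \<in> path_image u1" "a \<in> path_image u2" and b1: "b \<in> path_image v1" "b \<in> path_image v2"
    using pathstart_in_path_image[of u1] pathstart_in_path_image[of u2]
      pathfinish_in_path_image[of v1] pathfinish_in_path_image[of v2] 1(3,6) 2(3,6) by simp_all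
  have a: "a \<in> path_image u1" "a \<in> path_image u2" "a \<notin> path_image v1" "a \<notin> path_image v2"
    and b: "b \<in> path_image v1" "b \<in> path_image v2" "b \<notin> path_image u1" "b \<notin> path_image u2"
    using a1 b1 1(8) 2(8) ne_ab by (metis IntI singletonD)+
  have u: "path_image u1 \<inter> path_image u2 = {a}" and v: "path_image v1 \<inter> path_image v2 = {b}"
    and uv: "path_image u1 \<inter> path_image v2 = {}" "path_image u2 \<inter> path_image v1 = {}"
  proof -
    have "path_image u1 \<subseteq> path_image \<alpha>" "path_image v1 \<subseteq> path_image \<alpha>" "path_image u2 \<subseteq> path_image \<beta>" "path_image v2 \<subseteq> path_image \<beta>"
      using 1(7) 2(7) by auto
    then have "path_image u1 \<inter> path_image u2 \<subseteq> {a, b}" "path_image v1 \<inter> path_image v2 \<subseteq> {a, b}"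
      "path_image u1 \<inter> path_image v2 \<subseteq> {a, b}" "path_image u2 \<inter> path_image v1 \<subseteq> {a, b}"
      using Int by blast+
    then show "path_image u1 \<inter> path_image u2 = {a}" "path_image v1 \<inter> path_image v2 = {b}"
      "path_image u1 \<inter> path_image v2 = {}" "path_image u2 \<inter> path_image v1 = {}"
      using a b by auto
  qed
  \<comment> \<open>\<open>c1\<close> and \<open>c2\<close> are the two arcs of \<open>J\<close>
    between the ends of \<open>c\<close>, the first through \<open>a\<close> and the second through
    \<open>b\<close>.\<close>
  define c1 where "c1 = reversepath u1 +++ u2"
  define c2 where "c2 = v1 +++ reversepath v2"
  have im: "path_image c1 = path_image u1 \<union> path_image u2" "path_image c2 = path_image v1 \<union> path_image v2"
    unfolding c1_def c2_def using 1 2 by (simp_all add: path_image_join)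
  have arcs: "arc c1" "arc c2"
    unfolding c1_def c2_def using 1 2 u v by (auto intro!: arc_join simp: arc_reversepath)
  have st: "pathstart c1 = ?x" "pathfinish c1 = ?y" "pathstart c2 = ?x" "pathfinish c2 = ?y"
    unfolding c1_def c2_def using 1 2 by auto
  have xy: "?x \<noteq> ?y" using arc_distinct_ends[OF c(1)] by simp
  have J12: "path_image c1 \<union> path_image c2 = J"
    unfolding im J_def using 1(7) 2(7) by auto
  have disjJ: "path_image c \<inter> J \<subseteq> {?x, ?y}"
    using sub inside_no_overlap[of J] by blast
  have mem: "?x \<in> path_image u1" "?y \<in> path_image u2" "?x \<in> path_image v1" "?y \<in> path_image v2"
    using 1(8) 2(8) by auto
  have c12: "path_image c1 \<inter> path_image c2 = {?x, ?y}"
    unfolding im using 1(8) 2(8) uv by auto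
  have c1c: "path_image c1 \<inter> path_image c = {?x, ?y}" and c2c: "path_image c2 \<inter> path_image c = {?x, ?y}"
    using disjJ J12 c12 by auto
  have split: "inside (path_image c1 \<union> path_image c) \<inter> inside (path_image c2 \<union> path_image c) = {}"
    "inside (path_image c1 \<union> path_image c) \<union> inside (path_image c2 \<union> path_image c) \<union> (path_image c - {?x, ?y}) = inside J"
    by (rule split_inside_simple_closed_curve[of c1 ?x ?y c2 c];
        use arcs c(1) st xy c12 c1c c2c ne J12 in \<open>simp add: arc_imp_simple_path\<close>)+
  define A where "A = (path_image c1 \<union> path_image c) \<union> inside (path_image c1 \<union> path_image c)"
  define B where "B = (path_image c2 \<union> path_image c) \<union> inside (path_image c2 \<union> path_image c)"
  have "closed A" "closed B"
  proof -
    have "path (c1 +++ reversepath c)" "path (c2 +++ reversepath c)"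
      using arcs c(1) st by (auto simp: arc_imp_path)
    moreover have "path_image (c1 +++ reversepath c) = path_image c1 \<union> path_image c"
       "path_image (c2 +++ reversepath c) = path_image c2 \<union> path_image c"
      using st by (simp_all add: path_image_join)
    ultimately show "closed A" "closed B"
      unfolding A_def B_def by (metis closed_path_image_Un_inside)+
  qed
  moreover have "inside J \<subseteq> A \<union> B"
    unfolding A_def B_def split(2)[symmetric] by auto
  moreover have "A \<inter> B = path_image c"
  proof -
    have "inside (path_image c1 \<union> path_image c) \<inter> J = {}" "inside (path_image c2 \<union> path_image c) \<inter> J = {}"
      using split(2) inside_no_overlap[of J] by blast+
    moreover have "path_image c1 \<subseteq> J" "path_image c2 \<subseteq> J" using J12 by auto
    moreover have "inside (path_image c1 \<union> path_image c) \<inter> path_image c = {}" "inside (path_image c2 \<union> path_image c) \<inter> path_image c = {}"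
      using inside_no_overlap by blast+
    ultimately show ?thesis
      unfolding A_def B_def using split(1) c12 c1c by auto
  qed
  moreover have "a \<in> A" "b \<in> B" unfolding A_def B_def im using a b by auto
  ultimately show ?thesis using that by blast
qed

text \<open>A separation of the set into a part at \<open>a\<close> and a part at \<open>b\<close> would, by Janiszewski's theorem
  (applied once for each part), leave a way from \<open>\<alpha>\<close> to \<open>\<beta>\<close>, hence from \<open>G\<close> to \<open>U\<close>, inside the curve.\<close>

lemma connected_closed_Int_inside:
  assumes open_GU: "open G" "open U" "G \<inter> U = {}" and K: "K = - (G \<union> U)" "connected K"
    and G: "path_image \<alpha> - {a, b} \<subseteq> G" and U: "path_image \<beta> - {a, b} \<subseteq> U" and abK: "a \<in> K" "b \<in> K"
  shows "connected (insert a (insert b (K \<inter> inside J)))"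
proof -
  define S where "S = insert a (insert b (K \<inter> inside J))"
  have clK: "closed K" unfolding K(1) using open_GU by (intro closed_Compl open_Un)
  have KJ: "K \<inter> J = {a, b}" using G U abK K ab unfolding J_def by auto
  have clI: "closure (inside J) = inside J \<union> J"
    using Jordan(11) closure_Un_frontier by blast
  have S: "S = K \<inter> closure (inside J)" unfolding S_def clI using KJ by auto
  have abJ: "a \<in> J" "b \<in> J" using ab unfolding J_def by auto
  then have abI: "a \<notin> inside J" "b \<notin> inside J" using inside_no_overlap[of J] by blast+
  have compact_S: "compact S" unfolding S using clK Jordan(7) by (simp add: closed_Int_compact)
  \<comment> \<open>If one part contains both \<open>a\<close> and \<open>b\<close>, the other lies
    inside \<open>J\<close> and is separated from all the rest of \<open>K\<close>, which is
    connected.\<close>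
  have not_both: "B = {}" if "closed A" "closed B" "A \<union> B = S" "A \<inter> B = {}" "a \<in> A" "b \<in> A" for A B
  proof (rule ccontr)
    assume "B \<noteq> {}"
    have BI: "B \<subseteq> K \<inter> inside J" using that unfolding S_def by blast
    have "closed (A \<union> (K - inside J))" using that clK Jordan(2) by (simp add: closed_Diff closed_Un)
    moreover have "K \<subseteq> B \<union> (A \<union> (K - inside J))" using that(3) unfolding S_def by blast
    moreover have "B \<inter> (A \<union> (K - inside J)) = {}" using that(4) BI by blast
    moreover have "a \<in> K \<inter> (A \<union> (K - inside J))" using that abK by blast
    moreover have "B \<inter> K \<noteq> {}" using BI \<open>B \<noteq> {}\<close> by blast
    ultimately show False
      using K(2) that(2) unfolding connected_closed by blast
  qed
  have not_split: False if A: "closed A" "closed B" "A \<union> B = S" "A \<inter> B = {}" "a \<in> A" "b \<in> B" for A B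
  proof -
    have cpt: "compact A" "compact B"
      using A(1-3) compact_S by (metis Un_upper1 Un_upper2 bounded_subset compact_eq_bounded_closed)+
    have AJ: "A \<inter> J = {a}" "B \<inter> J = {b}"
    proof -
      have "S \<inter> J = {a, b}" unfolding S_def using abJ inside_no_overlap[of J] by blast
      then show "A \<inter> J = {a}" "B \<inter> J = {b}" using A(3-6) by blast+
    qed
    obtain x where x: "x \<in> path_image \<alpha> - {a, b}"
      by (rule arc_ex_inner_point[OF arc(1), unfolded ends])
    obtain y where y: "y \<in> path_image \<beta> - {a, b}"
      by (rule arc_ex_inner_point[OF arc(2), unfolded ends])
    obtain e1 where e1: "e1 > 0" "ball x e1 \<subseteq> G" using x G open_GU(1) by (meson open_contains_ball subsetD)
    obtain e2 where e2: "e2 > 0" "ball y e2 \<subseteq> U" using y U open_GU(2) by (meson open_contains_ball subsetD)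
    have xyJ: "x \<in> J" "y \<in> J" using x y unfolding J_def by auto
    then have "x \<in> closure (inside J)" "y \<in> closure (inside J)" unfolding clI by auto
    then obtain x' y' where x': "x' \<in> inside J" "x' \<in> ball x e1" and y': "y' \<in> inside J" "y' \<in> ball y e2"
      unfolding closure_approachable using e1(1) e2(1) by (metis dist_commute mem_ball)
    have ballK: "ball x e1 \<inter> S = {}" "ball y e2 \<inter> S = {}" using e1 e2 K(1) S by auto
    \<comment> \<open>\<open>T\<close> meets \<open>J\<close> in \<open>t\<close> only, so
      \<open>x'\<close> and \<open>y'\<close> can be joined along \<open>J - {t}\<close> and the two
      small balls.\<close>
    have around: "connected_component (- T) x' y'" if T: "T \<subseteq> S" "T \<inter> J = {t}" "t = a \<or> t = b" for T t
    proof -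
      have "x \<in> J - {t}" "y \<in> J - {t}" using x y T(3) unfolding J_def by auto
      moreover have "connected (J - {t})" using connected_J_minus T(3) by auto
      ultimately have "connected ((J - {t}) \<union> ball x e1 \<union> ball y e2)"
        using e1(1) e2(1) by (intro connected_Un) (auto simp: disjoint_iff)
      moreover have "(J - {t}) \<union> ball x e1 \<union> ball y e2 \<subseteq> - T" using T ballK by auto
      ultimately show ?thesis unfolding connected_component_def using x' y' by blast
    qed
    have "A \<subseteq> S" "B \<subseteq> S" using A(3) by auto
    then have aroundA: "connected_component (- A) x' y'" and aroundB: "connected_component (- B) x' y'"
      using around AJ by blast+
    \<comment> \<open>None of \<open>- inside J\<close>, \<open>A\<close> and \<open>B\<close>
      separates \<open>x'\<close> from \<open>y'\<close>. They are united one after the other; the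
      new set meets the previous union in the single point \<open>a\<close>, then \<open>b\<close>,
      so Janiszewski's theorem applies each time.\<close>
    have "connected_component (- (- inside J)) x' y'"
      unfolding connected_component_def using Jordan(3) x' y' by auto
    moreover have "A \<inter> - inside J = {a}"
      using AJ(1) A(3) abI unfolding S clI by auto
    ultimately have "connected_component (- (A \<union> - inside J)) x' y'"
      using Janiszewski[of A "- inside J"] cpt(1) Jordan(2) aroundA by (simp add: closed_Compl)
    moreover have "B \<inter> (A \<union> - inside J) = {b}"
      using AJ(2) A(3,4) abI unfolding S clI by auto
    ultimately have "connected_component (- (B \<union> (A \<union> - inside J))) x' y'"
      using Janiszewski[of B "A \<union> - inside J"] cpt(2) A(1) Jordan(2) aroundB by (simp add: closed_Compl closed_Un)
    then obtain T where T: "connected T" "T \<subseteq> - (B \<union> (A \<union> - inside J))" "x' \<in> T" "y' \<in> T"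
      unfolding connected_component_def by blast
    \<comment> \<open>Inside \<open>J\<close> and off \<open>S\<close> only \<open>G\<close> and
      \<open>U\<close> are left, and the connected set \<open>T\<close> would join them.\<close>
    have "T \<subseteq> G \<union> U" using T(2) A(3) unfolding S_def K(1) by blast
    then show False
      using T(1,3,4) open_GU x'(2) y'(2) e1(2) e2(2) unfolding connected_def by blast
  qed
  have "connected S"
    unfolding connected_closed_set[OF compact_imp_closed[OF compact_S]]
  proof
    assume "\<exists>A B. closed A \<and> closed B \<and> A \<noteq> {} \<and> B \<noteq> {} \<and> A \<union> B = S \<and> A \<inter> B = {}"
    then obtain A B where AB: "closed A" "closed B" "A \<noteq> {}" "B \<noteq> {}" "A \<union> B = S" "A \<inter> B = {}" by blast
    have "a \<in> A \<union> B" "b \<in> A \<union> B" "B \<union> A = S" "B \<inter> A = {}" using AB(5,6) unfolding S_def by auto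
    then show False
      using not_both[OF AB(1,2,5,6)] not_both[OF AB(2,1)] not_split[OF AB(1,2,5,6)] not_split[OF AB(2,1)] AB(3,4) by blast
  qed
  then show ?thesis unfolding S_def .
qed

text \<open>Each point \<open>p\<close> of \<open>K\<close> inside \<open>J\<close>, other than
  \<open>z\<close>, is accessible from both sides. Arcs through \<open>G\<close> and
  \<open>U\<close> form a crosscut meeting the set in \<open>p\<close> alone, so \<open>p\<close>
  separates \<open>a\<close> from \<open>b\<close>. The exception \<open>z\<close> is reserved for
  the image of infinity.\<close>

theorem arc_inside:
  assumes GU: "open G" "open U" "connected G" "connected U" "G \<inter> U = {}" and K: "K = - (G \<union> U)" "connected K"
    and G: "path_image \<alpha> - {a, b} \<subseteq> G" and U: "path_image \<beta> - {a, b} \<subseteq> U" and abK: "a \<in> K" "b \<in> K"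
    and z: "z \<noteq> a" "z \<noteq> b"
    and access: "\<And>p. \<lbrakk>p \<in> K \<inter> inside J; p \<noteq> z\<rbrakk> \<Longrightarrow> accessible_from G p \<and> accessible_from U p"
  obtains g where "arc g" "path_image g = insert a (insert b (K \<inter> inside J))" "pathstart g = a" "pathfinish g = b"
proof (rule arc_of_separating_points)
  define S where "S = insert a (insert b (K \<inter> inside J))"
  have clK: "closed K" unfolding K(1) using GU by (intro closed_Compl open_Un)
  have KJ: "K \<inter> J = {a, b}" using G U abK K ab unfolding J_def by auto
  have clI: "closure (inside J) = inside J \<union> J"
    using Jordan(11) closure_Un_frontier by blast
  have S: "S = K \<inter> closure (inside J)" unfolding S_def clI using KJ by auto
  show compact_S: "compact (insert a (insert b (K \<inter> inside J)))"
    unfolding S_def[symmetric] S using clK Jordan(7) by (simp add: closed_Int_compact)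
  show "connected (insert a (insert b (K \<inter> inside J)))"
    using connected_closed_Int_inside[OF GU(1,2,5) K G U abK] .
  show "\<exists>A B. closed A \<and> closed B \<and> A \<union> B = insert a (insert b (K \<inter> inside J)) \<and> A \<inter> B = {p} \<and> a \<in> A \<and> b \<in> B"
    if "p \<in> insert a (insert b (K \<inter> inside J)) - {a, b, z}" for p
  proof -
    have p: "p \<in> K" "p \<in> inside J" "p \<notin> G" "p \<notin> U" using that K by auto
    have acc: "accessible_from G p" "accessible_from U p" using access[of p] that by auto
    obtain x where x: "x \<in> path_image \<alpha> - {a, b}"
      by (rule arc_ex_inner_point[OF arc(1), unfolded ends])
    obtain y where y: "y \<in> path_image \<beta> - {a, b}"
      by (rule arc_ex_inner_point[OF arc(2), unfolded ends])
    have xy: "x \<in> G" "y \<in> U" "x \<notin> inside J" "y \<notin> inside J"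
    proof -
      have "x \<in> J" "y \<in> J" using x y unfolding J_def by auto
      then show "x \<notin> inside J" "y \<notin> inside J" using inside_no_overlap[of J] by blast+
    qed (use x y G U in auto)
    obtain g where g: "arc g" "pathstart g = p" "pathfinish g \<in> frontier (inside J) \<inter> G"
      "path_image g - {p, pathfinish g} \<subseteq> G" "path_image g - {pathfinish g} \<subseteq> inside J"
      using accessible_arc_to_frontier[OF GU(1,3) acc(1) Jordan(2) p(2,3) xy(1,3)] by blast
    obtain h where h: "arc h" "pathstart h = p" "pathfinish h \<in> frontier (inside J) \<inter> U"
      "path_image h - {p, pathfinish h} \<subseteq> U" "path_image h - {pathfinish h} \<subseteq> inside J"
      using accessible_arc_to_frontier[OF GU(2,4) acc(2) Jordan(2) p(2,4) xy(2,4)] by blast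
    define c where "c = reversepath g +++ h"
    have gG: "path_image g - {p} \<subseteq> G" and hU: "path_image h - {p} \<subseteq> U" using g h by auto
    have gh: "path_image g \<inter> path_image h = {p}"
      using gG hU GU(5) g(2) h(2) pathstart_in_path_image[of g] pathstart_in_path_image[of h] by auto
    have c: "arc c" "pathstart c = pathfinish g" "pathfinish c = pathfinish h" "path_image c = path_image g \<union> path_image h"
      unfolding c_def using g h gh by (auto intro!: arc_join simp: arc_reversepath path_image_join)
    \<comment> \<open>This end lies on \<open>J\<close> and in \<open>G\<close>, whereas
      \<open>\<beta>\<close> runs through \<open>U\<close> except for its ends, which lie in
      \<open>K\<close>.\<close>
    have "pathfinish g \<in> path_image \<alpha> - {a, b}"
      using g(3) abK K(1) U GU(5) unfolding Jordan(11) by (auto simp: J_def)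
    moreover have "pathfinish h \<in> path_image \<beta> - {a, b}"
      using h(3) abK K(1) G GU(5) unfolding Jordan(11) by (auto simp: J_def)
    moreover have "path_image c - {pathstart c, pathfinish c} \<subseteq> inside J" using c g(5) h(5) by auto
    moreover have "path_image c \<inter> inside J \<noteq> {}" using c gh p(2) by auto
    ultimately obtain A B where AB: "closed A" "closed B" "inside J \<subseteq> A \<union> B" "A \<inter> B = path_image c" "a \<in> A" "b \<in> B"
      using crosscut_separates[OF c(1)] c(2,3) by metis
    have cS: "S \<inter> path_image c = {p}"
      using c(4) gG hU gh p(1,2) K(1) abK unfolding S_def by auto
    have "closed (S \<inter> A)" "closed (S \<inter> B)" using closed_Int[OF compact_imp_closed[OF compact_S]] AB(1,2) unfolding S_def by auto
    moreover have "(S \<inter> A) \<union> (S \<inter> B) = S" using AB(3,5,6) unfolding S_def by blast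
    moreover have "(S \<inter> A) \<inter> (S \<inter> B) = {p}" using AB(4) cS by blast
    moreover have "a \<in> S \<inter> A" "b \<in> S \<inter> B" using AB unfolding S_def by auto
    ultimately show ?thesis unfolding S_def[symmetric] by blast
  qed
qed (use ab z that in auto)

end

section \<open>Inversion\<close>

text \<open>Since \<open>inverse 0 = 0\<close>, this is injective on the whole plane and sends
  \<open>c\<close> to 0. For a set not containing \<open>c\<close> the value 0 is free and stands
  for the point at infinity.\<close>

definition invert :: "complex \<Rightarrow> complex \<Rightarrow> complex" where
  "invert c z = inverse (z - c)"

lemma invert_eq_0_iff [simp]: "invert c z = 0 \<longleftrightarrow> z = c"
  unfolding invert_def by simp

lemma invert_inverse [simp]: "invert c (c + inverse w) = w" "c + inverse (invert c z) = z"
  unfolding invert_def by simp_all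

lemma inj_invert: "inj (invert c)"
  by (metis injI invert_inverse(2))

lemma continuous_on_invert: "c \<notin> X \<Longrightarrow> continuous_on X (invert c)"
  unfolding invert_def by (auto intro!: continuous_intros)

lemma invert_image_eq: "c \<notin> X \<Longrightarrow> invert c ` X = - {0} \<inter> (\<lambda>w. c + inverse w) -` X"
  by (auto simp: image_iff) (metis invert_inverse(1))

lemma open_invert_image:
  assumes "open X" "c \<notin> X"
  shows "open (invert c ` X)"
  unfolding invert_image_eq[OF assms(2)]
  by (rule continuous_open_preimage) (use assms in \<open>auto intro!: continuous_intros\<close>)

lemma connected_invert_image: "\<lbrakk>connected X; c \<notin> X\<rbrakk> \<Longrightarrow> connected (invert c ` X)"
  by (intro connected_continuous_image continuous_on_invert)

lemma zero_in_closure_invert_image: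
  assumes "\<not> bounded X"
  shows "0 \<in> closure (invert c ` X)"
  unfolding closure_approachable
proof (intro allI impI)
  fix e :: real assume "e > 0"
  obtain x where x: "x \<in> X" "norm x > norm c + 1 / e"
    using assms unfolding bounded_iff by (metis not_le_imp_less)
  then have "norm (x - c) > 1 / e" using norm_triangle_ineq2[of x c] by linarith
  moreover have "1 / e > 0" using \<open>e > 0\<close> by simp
  ultimately have "inverse (norm (x - c)) < inverse (1 / e)" by (intro less_imp_inverse_less) auto
  then have "dist (invert c x) 0 < e" unfolding invert_def by (simp add: norm_inverse)
  then show "\<exists>y\<in>invert c ` X. dist y 0 < e" using x by blast
qed

text \<open>\<open>c\<close> has to be removed on the right because \<open>invert c c = 0\<close>,
  the value that represents infinity.\<close>

lemma compl_insert_invert_image: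
  assumes "c \<notin> X"
  shows "- insert 0 (invert c ` X) = invert c ` (- X - {c})"
  using invert_image_eq[OF assms] invert_image_eq[of c "- X - {c}"] by auto

lemma bounded_invert_image:
  assumes "open N" "c \<in> N" "X \<inter> N = {}"
  shows "bounded (invert c ` X)"
proof -
  obtain e where e: "e > 0" "ball c e \<subseteq> N" using assms open_contains_ball by blast
  have "norm (invert c x) \<le> inverse e" if "x \<in> X" for x
  proof -
    have "x \<notin> ball c e" using e assms(3) that by blast
    then have "e \<le> norm (x - c)" by (simp add: dist_norm norm_minus_commute)
    then show ?thesis unfolding invert_def using e(1) by (simp add: norm_inverse le_imp_inverse_le)
  qed
  then show ?thesis unfolding bounded_iff by blast
qed

lemma compact_insert_invert_image:
  assumes "closed X" "c \<notin> X"
  shows "compact (insert 0 (invert c ` X))"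
proof -
  have "open (- insert 0 (invert c ` X))"
    unfolding compl_insert_invert_image[OF assms(2)] using assms by (intro open_invert_image open_Diff) auto
  moreover have "bounded (invert c ` X)"
    by (rule bounded_invert_image[of "- X"]) (use assms in auto)
  ultimately show ?thesis by (simp add: compact_eq_bounded_closed closed_def)
qed

lemma connected_insert_invert_image:
  assumes "connected X" "c \<notin> X" "\<not> bounded X"
  shows "connected (insert 0 (invert c ` X))"
  by (rule connected_intermediate_closure[OF connected_invert_image[OF assms(1,2)]])
     (use zero_in_closure_invert_image[OF assms(3), of c] closure_subset[of "invert c ` X"] in blast)+

text \<open>Inverted and with 0 added, \<open>X\<close> and \<open>Y\<close> become continua meeting
  in exactly two points, 0 and the image of \<open>p\<close>. By the dual of Janiszewski's theorem a
  connected complement of their union would make this intersection connected.\<close>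

lemma not_connected_compl_Un:
  fixes X Y :: "complex set"
  assumes "closed X" "connected X" "\<not> bounded X" "closed Y" "connected Y" "\<not> bounded Y" "X \<inter> Y = {p}"
    and c: "c \<notin> X \<union> Y"
  shows "\<not> connected (- (X \<union> Y))"
proof
  assume conn: "connected (- (X \<union> Y))"
  define A where "A = insert 0 (invert c ` X)"
  define B where "B = insert 0 (invert c ` Y)"
  have AB: "compact A" "compact B" "connected A" "connected B"
    unfolding A_def B_def using assms by (auto intro!: compact_insert_invert_image connected_insert_invert_image)
  have "A \<union> B = insert 0 (invert c ` (X \<union> Y))" unfolding A_def B_def by auto
  moreover have "connected (- (X \<union> Y) - {c})"
    by (rule connected_open_delete) (use assms conn in auto)
  ultimately have "connected (- (A \<union> B))"
    using compl_insert_invert_image[OF c] connected_invert_image[of "- (X \<union> Y) - {c}" c] by simp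
  then have "connected (A \<inter> B)"
    using Janiszewski_dual AB by blast
  moreover have "A \<inter> B = {0, invert c p}"
  proof -
    have "invert c ` X \<inter> invert c ` Y = invert c ` {p}"
      unfolding assms(7)[symmetric] using inj_invert by (simp add: image_Int)
    moreover have "0 \<notin> invert c ` X" "0 \<notin> invert c ` Y" using c by (auto simp: image_iff)
    ultimately show ?thesis unfolding A_def B_def by auto
  qed
  ultimately have "invert c p = 0"
    using connected_finite_iff_sing[of "{0, invert c p}"] by auto
  then have "p = c" by simp
  then show False using assms(7) c by blast
qed

section \<open>Connectedness of the complementary interior\<close>

lemma ex_other_component:
  assumes "\<not> connected S" "C \<in> components S"
  obtains C' where "C' \<in> components S" "C' \<noteq> C"
proof -
  have "\<not> components S \<subseteq> {C}"
  proof
    assume "components S \<subseteq> {C}"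
    then have "components S = {C}" using assms(2) by blast
    then show False using assms(1) components_eq_sing_exists[of S] by blast
  qed
  then show ?thesis using that by blast
qed

context regular_function
begin

lemma accessible_from_frontier:
  assumes "open X" "p \<in> frontier X" "e > 0" "frontier X \<inter> ball p e \<subseteq> {z. f z = 0}"
  shows "accessible_from X p"
proof -
  obtain g where "path g" "pathfinish g = p" "pathstart g \<in> X" "path_image g - {p} \<subseteq> X \<inter> {z. f z \<noteq> 0}"
    using accessible[OF assms] .
  then show ?thesis unfolding accessible_from_def by blast
qed

text \<open>Each member that meets the open box contains a whole component of the nonzero set in the
  closed box. Disjoint members contain different ones, and there are only finitely many.\<close>

lemma locally_finite_components:
  assumes "\<And>G. G \<in> \<G> \<Longrightarrow> open G" "\<And>G. G \<in> \<G> \<Longrightarrow> frontier G \<subseteq> {z. f z = 0}" "disjoint \<G>"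
  obtains N where "open N" "p \<in> N" "finite {G \<in> \<G>. G \<inter> N \<noteq> {}}"
proof -
  obtain c d where cd: "p \<in> box c d" "finite (components ({z. f z \<noteq> 0} \<inter> cbox c d))"
    using ex_box[of 1 p] by auto
  have "\<exists>W\<in>components ({z. f z \<noteq> 0} \<inter> cbox c d). W \<subseteq> G" if G: "G \<in> \<G>" "G \<inter> box c d \<noteq> {}" for G
  proof -
    obtain w where w: "w \<in> G \<inter> box c d" "f w \<noteq> 0"
      using ex_nonzero[of "G \<inter> box c d"] G assms(1) by blast
    then have "w \<in> {z. f z \<noteq> 0} \<inter> cbox c d" using box_subset_cbox[of c d] by blast
    then obtain W where W: "W \<in> components ({z. f z \<noteq> 0} \<inter> cbox c d)" "w \<in> W"
      using Union_components by (metis UnionE)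
    have "W \<subseteq> G"
      by (rule subset_if_frontier_zero)
         (use W w in_components_connected[OF W(1)] in_components_subset[OF W(1)] assms(2)[OF G(1)] in auto)
    then show ?thesis using W by blast
  qed
  then obtain W where W: "\<And>G. G \<in> \<G> \<Longrightarrow> G \<inter> box c d \<noteq> {} \<Longrightarrow> W G \<in> components ({z. f z \<noteq> 0} \<inter> cbox c d) \<and> W G \<subseteq> G"
    by metis
  have "inj_on W {G \<in> \<G>. G \<inter> box c d \<noteq> {}}"
  proof (rule inj_onI)
    fix G H assume GH: "G \<in> {G \<in> \<G>. G \<inter> box c d \<noteq> {}}" "H \<in> {G \<in> \<G>. G \<inter> box c d \<noteq> {}}" "W G = W H"
    then have "W G \<noteq> {}" "W G \<subseteq> G" "W G \<subseteq> H"
      using W[of G] W[of H] in_components_nonempty[of "W G"] by auto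
    then have "G \<inter> H \<noteq> {}" by blast
    then show "G = H" using GH assms(3) unfolding disjoint_def by blast
  qed
  moreover have "finite (W ` {G \<in> \<G>. G \<inter> box c d \<noteq> {}})"
    by (rule finite_subset[OF _ cd(2)]) (use W in auto)
  ultimately have "finite {G \<in> \<G>. G \<inter> box c d \<noteq> {}}" by (rule finite_imageD[rotated])
  then show ?thesis using that[of "box c d"] cd(1) open_box by blast
qed

lemma closure_Union_components:
  assumes "\<And>G. G \<in> \<G> \<Longrightarrow> open G" "\<And>G. G \<in> \<G> \<Longrightarrow> frontier G \<subseteq> {z. f z = 0}" "disjoint \<G>"
    and "p \<in> closure (\<Union>\<G>)"
  obtains G where "G \<in> \<G>" "p \<in> closure G"
proof -
  obtain N where N: "open N" "p \<in> N" "finite {G \<in> \<G>. G \<inter> N \<noteq> {}}"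
    using locally_finite_components[OF assms(1-3)] by blast
  have "p \<in> closure (N \<inter> \<Union>\<G>)"
    using open_Int_closure_subset[OF N(1)] N(2) assms(4) by blast
  moreover have "closure (N \<inter> \<Union>\<G>) \<subseteq> \<Union>(closure ` {G \<in> \<G>. G \<inter> N \<noteq> {}})"
  proof (rule closure_minimal)
    show "N \<inter> \<Union>\<G> \<subseteq> \<Union>(closure ` {G \<in> \<G>. G \<inter> N \<noteq> {}})" using closure_subset by fastforce
  qed (use N(3) in auto)
  ultimately show ?thesis using that by blast
qed

text \<open>Two common frontier points would give a Jordan curve in \<open>M\<close>; its inside lies in \<open>M\<close> as well,
  and so joins the two components.\<close>

lemma frontier_Int_frontier_subsingleton:
  assumes M: "closed M" "M \<noteq> UNIV" "connected (- M)" "frontier M \<subseteq> {z. f z = 0}"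
    and G: "G \<in> components (interior M)" "H \<in> components (interior M)" "G \<noteq> H"
    and p: "p \<in> frontier G \<inter> frontier H" and q: "q \<in> frontier G \<inter> frontier H"
  shows "p = q"
proof (rule ccontr)
  assume "p \<noteq> q"
  have op: "open G" "open H" "connected G" "connected H"
    using open_components[OF _ G(1)] open_components[OF _ G(2)] in_components_connected[OF G(1)] in_components_connected[OF G(2)] by simp_all
  have fr: "frontier G \<subseteq> frontier M" "frontier H \<subseteq> frontier M"
    using frontier_of_components_subset G frontier_interior_subset by blast+
  have disj: "G \<inter> H = {}" using G components_nonoverlap by blast
  have acc: "accessible_from X r" if "X = G \<or> X = H" "r = p \<or> r = q" for X r
    by (rule accessible_from_frontier[of _ _ 1]) (use that op fr p q M(4) in auto)
  obtain \<alpha> where \<alpha>: "arc \<alpha>" "pathstart \<alpha> = p" "pathfinish \<alpha> = q" "path_image \<alpha> - {p, q} \<subseteq> G"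
    using accessible_arc_between[OF op(1,3) acc acc \<open>p \<noteq> q\<close>] by blast
  obtain \<beta> where \<beta>: "arc \<beta>" "pathstart \<beta> = p" "pathfinish \<beta> = q" "path_image \<beta> - {p, q} \<subseteq> H"
    using accessible_arc_between[OF op(2,4) acc acc \<open>p \<noteq> q\<close>] by blast
  have "path_image \<alpha> \<inter> path_image \<beta> = {p, q}"
    using \<alpha> \<beta> disj pathstart_in_path_image[of \<alpha>] pathfinish_in_path_image[of \<alpha>]
      pathstart_in_path_image[of \<beta>] pathfinish_in_path_image[of \<beta>] by auto
  then interpret two_arcs \<alpha> \<beta> p q
    by unfold_locales (use \<alpha> \<beta> in auto)
  have "p \<in> M" "q \<in> M" using p q fr frontier_subset_closed[OF M(1)] by blast+
  moreover have "G \<subseteq> M" "H \<subseteq> M" using G in_components_subset interior_subset by blast+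
  ultimately have JM: "J \<subseteq> M" unfolding J_def using \<alpha> \<beta> by blast
  \<comment> \<open>\<open>- M\<close> is connected, misses \<open>J\<close> and is unbounded, so it
    misses the inside of \<open>J\<close>.\<close>
  have "\<not> bounded (- M)"
    by (rule unbounded_if_frontier_zero) (use M in \<open>auto simp: frontier_complement\<close>)
  then have "\<not> - M \<subseteq> inside J" using Jordan(7) bounded_subset by blast
  then have "- M \<inter> inside J = {}"
    using connected_Int_frontier[OF M(3), of "inside J"] JM unfolding Jordan(11) by blast
  then have "inside J \<subseteq> interior M" using Jordan(2) by (intro interior_maximal) auto
  moreover have "inside J \<inter> X \<noteq> {}" if X: "open X" "x \<in> X" "x \<in> J" for X x
  proof -
    have "x \<in> closure (inside J)" using X(3) Jordan(11) unfolding frontier_def by blast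
    then show ?thesis using X open_Int_closure_eq_empty[OF X(1), of "inside J"] by blast
  qed
  moreover obtain x y where "x \<in> path_image \<alpha> - {p, q}" "y \<in> path_image \<beta> - {p, q}"
    using arc_ex_inner_point[OF \<alpha>(1)] arc_ex_inner_point[OF \<beta>(1)] \<alpha>(2,3) \<beta>(2,3) by metis
  ultimately have "G \<inter> inside J \<noteq> {}" "H \<inter> inside J \<noteq> {}"
    using \<alpha>(4) \<beta>(4) op unfolding J_def by blast+
  then have "inside J \<subseteq> G" "inside J \<subseteq> H"
    using components_maximal[OF G(1) Jordan(3)] components_maximal[OF G(2) Jordan(3)] \<open>inside J \<subseteq> interior M\<close> by blast+
  then show False using disj Jordan(1) by blast
qed

text \<open>If the closures of two components met in a single point, they would separate the plane. A
  complementary component missing \<open>- M\<close> would have at most two frontier points.\<close>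

lemma closure_Int_closure_components:
  assumes M: "closed M" "M \<noteq> UNIV" "connected (- M)" "frontier M \<subseteq> {z. f z = 0}"
    and G: "G \<in> components (interior M)" "H \<in> components (interior M)" "G \<noteq> H"
  shows "closure G \<inter> closure H = {}"
proof (rule ccontr)
  assume "closure G \<inter> closure H \<noteq> {}"
  then obtain p where p: "p \<in> closure G" "p \<in> closure H" by blast
  have comp: "open X" "connected X" "frontier X \<subseteq> frontier M" "X \<noteq> {}" "X \<subseteq> interior M" "\<not> bounded X" "closure X \<subseteq> M"
    if X: "X \<in> components (interior M)" for X
  proof -
    show "open X" "connected X" "X \<noteq> {}" "X \<subseteq> interior M"
      using open_components[OF _ X] in_components_connected[OF X] in_components_nonempty[OF X] in_components_subset[OF X] by simp_all
    show fr: "frontier X \<subseteq> frontier M"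
      using frontier_of_components_subset[OF X] frontier_interior_subset by blast
    show "\<not> bounded X"
      by (rule unbounded_if_frontier_zero) (use \<open>open X\<close> \<open>X \<noteq> {}\<close> fr M(4) in auto)
    show "closure X \<subseteq> M"
      using \<open>X \<subseteq> interior M\<close> M(1) interior_subset closure_minimal by (meson subset_trans)
  qed
  have cross: "closure X \<inter> closure Y = frontier X \<inter> frontier Y"
    if X: "X \<in> components (interior M)" "Y \<in> components (interior M)" "X \<noteq> Y" for X Y
  proof -
    have "X \<inter> Y = {}" using X components_nonoverlap by blast
    then have "X \<inter> closure Y = {}" "Y \<inter> closure X = {}"
      using open_Int_closure_eq_empty comp(1) X by (metis Int_commute)+
    then show ?thesis
      using comp(1)[OF X(1)] comp(1)[OF X(2)] by (auto simp: frontier_def interior_open)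
  qed
  have sub1: "x = y" if "X \<in> components (interior M)" "Y \<in> components (interior M)" "X \<noteq> Y"
      "x \<in> closure X \<inter> closure Y" "y \<in> closure X \<inter> closure Y" for X Y x y
    using frontier_Int_frontier_subsingleton[OF M that(1-3)] that(4,5) unfolding cross[OF that(1-3)] by blast
  have eq: "closure G \<inter> closure H = {p}" using sub1[OF G] p by blast
  obtain c where c: "c \<notin> M" using M(2) by blast
  have cl: "closure G \<subseteq> M" "closure H \<subseteq> M" using comp(7) G by blast+
  have "\<not> connected (- (closure G \<union> closure H))"
  proof (rule not_connected_compl_Un[OF _ _ _ _ _ _ eq])
    show "connected (closure G)" "connected (closure H)"
      using connected_imp_connected_closure comp(2) G by blast+
    show "\<not> bounded (closure G)" "\<not> bounded (closure H)"
      using comp(6) G bounded_subset closure_subset by blast+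
    show "c \<notin> closure G \<union> closure H" using c cl by blast
  qed auto
  have UM: "- M \<subseteq> - (closure G \<union> closure H)" using cl by blast
  obtain V0 where V0: "V0 \<in> components (- (closure G \<union> closure H))" "- M \<subseteq> V0"
    using exists_component_superset[OF UM _ M(3)] c cl by blast
  obtain V where V: "V \<in> components (- (closure G \<union> closure H))" "V \<noteq> V0"
    using ex_other_component[OF _ V0(1)] \<open>\<not> connected (- (closure G \<union> closure H))\<close> by blast
  have VM: "V \<inter> - M = {}"
    using components_nonoverlap[OF V(1) V0(1)] V(2) V0(2) by blast
  have oV: "open V"
    by (rule open_components[OF _ V(1)]) (intro open_Compl closed_Un closed_closure)
  then have "V \<subseteq> interior M" using VM interior_maximal[OF _ oV, of M] by blast
  have V_ne: "V \<noteq> {}" "connected V" using in_components_nonempty[OF V(1)] in_components_connected[OF V(1)] .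
  have "interior M \<noteq> {}" using \<open>V \<subseteq> interior M\<close> V_ne(1) by blast
  \<comment> \<open>\<open>V\<close> lies in a third component \<open>K\<close>, whose closure meets
    the closures of \<open>G\<close> and \<open>H\<close> in at most one point each.\<close>
  then obtain K where K: "K \<in> components (interior M)" "V \<subseteq> K"
    using exists_component_superset[OF \<open>V \<subseteq> interior M\<close> _ V_ne(2)] by blast
  have VG: "V \<inter> closure G = {}" "V \<inter> closure H = {}" using in_components_subset[OF V(1)] by blast+
  have "K \<noteq> G" "K \<noteq> H" using VG V_ne K(2) closure_subset by blast+
  have "frontier V \<subseteq> (closure K \<inter> closure G) \<union> (closure K \<inter> closure H)"
  proof -
    have "frontier V \<subseteq> frontier (closure G \<union> closure H)"
      using frontier_of_components_subset[OF V(1)] frontier_complement by blast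
    also have "\<dots> \<subseteq> closure G \<union> closure H" by (intro frontier_subset_closed) auto
    finally show ?thesis using closure_mono[OF K(2)] unfolding frontier_def by blast
  qed
  moreover have "finite (closure K \<inter> closure X)" if "X \<in> components (interior M)" "K \<noteq> X" for X
  proof (cases "closure K \<inter> closure X = {}")
    case False
    then obtain x where "x \<in> closure K \<inter> closure X" by blast
    then have "closure K \<inter> closure X \<subseteq> {x}" using sub1[OF K(1) that] by blast
    then show ?thesis using finite_subset by blast
  qed simp
  ultimately have "finite (frontier V)"
    using G K \<open>K \<noteq> G\<close> \<open>K \<noteq> H\<close> finite_subset by (metis finite_UnI)
  \<comment> \<open>A finite set does not separate the plane, so \<open>V\<close> would be the whole
    complement of its frontier. But \<open>V\<close> misses the unbounded set
    \<open>G\<close>.\<close>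
  then have "connected (- frontier V)"
    using connected_open_delete_finite[of UNIV "frontier V"] connected_UNIV by (simp add: Compl_eq_Diff_UNIV)
  moreover have "- frontier V \<inter> V \<noteq> {}"
    using V_ne(1) oV by (simp add: frontier_def interior_open)
  ultimately have "- frontier V \<subseteq> V"
    using connected_Int_frontier[of "- frontier V" V] by blast
  then have "G \<subseteq> frontier V" using VG closure_subset by blast
  then have "finite G" using \<open>finite (frontier V)\<close> finite_subset by blast
  then show False using comp(6)[OF G(1)] finite_imp_bounded by blast
qed

text \<open>The closure of one component and, by local finiteness, the closure of the union of all
  others are disjoint. Both meet the connected set \<open>frontier M\<close> and together they cover
  it.\<close>

theorem connected_interior:
  assumes M: "closed M" "M \<noteq> UNIV" "connected (- M)" "frontier M \<subseteq> {z. f z = 0}"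
    and fr: "connected (frontier M)" "frontier M \<subseteq> closure (interior M)"
  shows "connected (interior M)"
proof (rule ccontr)
  assume nc: "\<not> connected (interior M)"
  then have "components (interior M) \<noteq> {}" by auto
  then obtain G where G: "G \<in> components (interior M)" by blast
  obtain H where H: "H \<in> components (interior M)" "H \<noteq> G"
    using ex_other_component[OF nc G] .
  note GH = G H
  define \<R> where "\<R> = components (interior M) - {G}"
  have comp: "open X" "frontier X \<subseteq> frontier M" "X \<noteq> {}" "X \<subseteq> interior M"
    if X: "X \<in> components (interior M)" for X
    using open_components[OF _ X] in_components_nonempty[OF X] in_components_subset[OF X]
      frontier_of_components_subset[OF X] frontier_interior_subset[of M] by auto
  have \<R>: "open X" "frontier X \<subseteq> {z. f z = 0}" if "X \<in> \<R>" for X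
    using comp(1,2)[of X] M(4) that unfolding \<R>_def by auto
  have disj: "disjoint \<R>"
    unfolding disjoint_def \<R>_def using components_nonoverlap[of _ "interior M"] by auto
  have fr_ne: "frontier M \<inter> closure X \<noteq> {}" if X: "X \<in> components (interior M)" for X
  proof -
    have "X \<noteq> UNIV" using comp(4)[OF X] interior_subset M(2) by blast
    then have "frontier X \<noteq> {}" using frontier_not_empty comp(3)[OF X] by blast
    then show ?thesis using comp(2)[OF X] unfolding frontier_def by blast
  qed
  have "closure (interior M) = closure G \<union> closure (\<Union>\<R>)"
  proof -
    have "interior M = G \<union> \<Union>\<R>" using Union_components[of "interior M"] GH(1) unfolding \<R>_def by blast
    then show ?thesis by (metis closure_Un)
  qed
  then have "frontier M \<subseteq> closure G \<union> closure (\<Union>\<R>)" using fr(2) by simp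
  moreover have "closure G \<inter> closure (\<Union>\<R>) = {}"
  proof (rule ccontr)
    assume "closure G \<inter> closure (\<Union>\<R>) \<noteq> {}"
    then obtain p where p: "p \<in> closure G" "p \<in> closure (\<Union>\<R>)" by blast
    obtain X where "X \<in> \<R>" "p \<in> closure X" using closure_Union_components[OF \<R> disj p(2)] by blast
    then show False
      using closure_Int_closure_components[OF M GH(1), of X] p(1) unfolding \<R>_def by blast
  qed
  moreover have "frontier M \<inter> closure (\<Union>\<R>) \<noteq> {}"
  proof -
    have "closure H \<subseteq> closure (\<Union>\<R>)" using GH unfolding \<R>_def by (intro closure_mono) blast
    then show ?thesis using fr_ne[OF GH(2)] by blast
  qed
  ultimately show False
    using connected_closed_cover_disjoint[OF fr(1), of "closure G" "closure (\<Union>\<R>)"] fr_ne[OF GH(1)] by auto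
qed

end

section \<open>The frontier component as a simple closed curve\<close>

lemma arc_inj_image:
  assumes "arc g" "continuous_on (path_image g) h" "inj h"
  shows "arc (h \<circ> g)"
  using assms path_continuous_image[of g h] unfolding arc_def
  by (auto intro: comp_inj_on inj_on_subset)

lemma accessible_from_invert:
  assumes "accessible_from X p" "c \<notin> X" "c \<noteq> p"
  shows "accessible_from (invert c ` X) (invert c p)"
proof -
  obtain g where g: "path g" "pathstart g \<in> X" "pathfinish g = p" "path_image g - {p} \<subseteq> X"
    using assms(1) unfolding accessible_from_def by blast
  have "c \<notin> path_image g" using g(4) assms(2,3) by blast
  then have "path (invert c \<circ> g)" using path_continuous_image[OF g(1)] continuous_on_invert by blast
  moreover have "path_image (invert c \<circ> g) - {invert c p} \<subseteq> invert c ` X"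
    using g(4) unfolding path_image_compose by blast
  ultimately show ?thesis
    unfolding accessible_from_def using g(2,3)
    by (intro exI[of _ "invert c \<circ> g"]) (auto simp: pathstart_compose pathfinish_compose)
qed

lemma accessible_arc:
  fixes X :: "'a::euclidean_space set"
  assumes "accessible_from X p" "p \<notin> X"
  obtains g where "arc g" "pathstart g \<in> X" "pathfinish g = p" "path_image g - {p} \<subseteq> X"
proof -
  obtain h where h: "path h" "pathstart h \<in> X" "pathfinish h = p" "path_image h - {p} \<subseteq> X"
    using assms(1) unfolding accessible_from_def by blast
  obtain g where "arc g" "path_image g \<subseteq> path_image h" "pathstart g = pathstart h" "pathfinish g = p"
    using path_contains_arc[OF h(1) refl h(3)] h(2) assms(2) by blast
  then show ?thesis using that[of g] h by auto
qed

context two_arcs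
begin

lemma two_arcs_invert:
  assumes "c \<notin> J"
  shows "two_arcs (invert c \<circ> \<alpha>) (invert c \<circ> \<beta>) (invert c a) (invert c b)"
proof
  have c: "c \<notin> path_image \<alpha>" "c \<notin> path_image \<beta>" using assms unfolding J_def by auto
  show "arc (invert c \<circ> \<alpha>)" "arc (invert c \<circ> \<beta>)"
    using arc c by (auto intro: arc_inj_image continuous_on_invert inj_invert)
  show "path_image (invert c \<circ> \<alpha>) \<inter> path_image (invert c \<circ> \<beta>) = {invert c a, invert c b}"
    unfolding path_image_compose image_Int[OF inj_invert, symmetric] Int by simp
qed (simp_all add: pathstart_compose pathfinish_compose ends)

text \<open>\<open>P\<close> and \<open>Q\<close> are connected and fill the complement of the
  inverted curve. \<open>Q\<close> is bounded because the outside of \<open>J\<close> stays away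
  from \<open>c\<close>; so \<open>P\<close> must be in the outside of the new curve, and
  \<open>Q\<close> is its inside.\<close>

lemma inside_invert:
  assumes c: "c \<in> inside J"
  shows "inside (invert c ` J) = insert 0 (invert c ` outside J)"
proof -
  have cJ: "c \<notin> J" "c \<notin> outside J" using c Jordan(9,10) by blast+
  interpret T: two_arcs "invert c \<circ> \<alpha>" "invert c \<circ> \<beta>" "invert c a" "invert c b"
    using two_arcs_invert[OF cJ(1)] .
  have TJ: "T.J = invert c ` J" unfolding T.J_def J_def path_image_compose by blast
  define P where "P = invert c ` (inside J - {c})"
  define Q where "Q = insert 0 (invert c ` outside J)"
  have "- insert 0 (invert c ` J) = invert c ` (- J - {c})"
    using compl_insert_invert_image[OF cJ(1)] .
  also have "\<dots> = P \<union> invert c ` outside J"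
    unfolding P_def Jordan(10)[symmetric] using cJ by blast
  finally have PQ: "- T.J = P \<union> Q"
    unfolding TJ Q_def using cJ(1) by (auto simp: image_iff)
  have P: "connected P"
    unfolding P_def by (intro connected_invert_image connected_open_delete Jordan) auto
  have Q: "connected Q" "bounded Q"
  proof -
    show "connected Q"
      unfolding Q_def by (intro connected_insert_invert_image Jordan cJ)
    have "bounded (invert c ` outside J)"
      by (rule bounded_invert_image[OF Jordan(2) c]) (use Jordan(9) in blast)
    then show "bounded Q" unfolding Q_def by simp
  qed
  have "\<not> outside T.J \<subseteq> Q" using Q(2) T.Jordan(8) bounded_subset by blast
  then have "P \<inter> outside T.J \<noteq> {}" using T.Jordan(10) PQ by blast
  then have "P \<subseteq> outside T.J"
    using connected_Int_frontier[OF P, of "outside T.J"] PQ unfolding T.Jordan(12) by blast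
  then have sub: "inside T.J \<subseteq> Q" using T.Jordan(9,10) PQ by blast
  then have "Q \<inter> inside T.J \<noteq> {}" using T.Jordan(1) by blast
  then have "Q \<subseteq> inside T.J"
    using connected_Int_frontier[OF Q(1), of "inside T.J"] PQ unfolding T.Jordan(11) by blast
  then show ?thesis using sub unfolding TJ Q_def by blast
qed

end

section \<open>The two sides of a component of the frontier\<close>

context regular_function
begin

text \<open>Puncturing \<open>X\<close> may add \<open>c\<close> to its frontier, where
  \<open>f\<close> need not vanish. The radius \<open>dist p c\<close> keeps \<open>c\<close> out of
  the ball in which zeros are required.\<close>

lemma accessible_from_Diff_singleton:
  assumes "open X" "p \<in> frontier X" "frontier X \<subseteq> {z. f z = 0}" "p \<noteq> c"
  shows "accessible_from (X - {c}) p"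
proof (rule accessible_from_frontier[where e = "dist p c"])
  have op: "open (X - {c})" using assms(1) by (simp add: open_delete)
  have "closure X \<subseteq> insert c (closure (X - {c}))"
    using closure_mono[of X "{c} \<union> (X - {c})"] by (simp only: closure_Un closure_closed[OF closed_singleton]) auto
  moreover have "closure (X - {c}) \<subseteq> closure X" by (intro closure_mono) auto
  ultimately show "p \<in> frontier (X - {c})" "frontier (X - {c}) \<inter> ball p (dist p c) \<subseteq> {z. f z = 0}"
    using assms op by (auto simp: frontier_def interior_open)
qed (use assms in \<open>auto simp: open_delete\<close>)

text \<open>\<open>G\<close> and \<open>U\<close> are the interior and the complement of the
  component \<open>M\<close> of \<open>- D\<close> that contains \<open>C\<close>. The frontier of
  \<open>M\<close> is connected, lies in \<open>frontier D\<close> and contains \<open>C\<close>, so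
  it equals \<open>C\<close>.\<close>

lemma component_frontier_sides:
  assumes D: "D \<in> components {z. f z \<noteq> 0}" and C: "C \<in> components (frontier D)"
  obtains G U where "open G" "open U" "connected G" "connected U" "G \<inter> U = {}" "C = - (G \<union> U)"
    "frontier G = C" "frontier U = C" "C \<subseteq> {z. f z = 0}"
proof -
  have D': "open D" "connected D" "D \<noteq> {}" "D \<subseteq> {z. f z \<noteq> 0}"
    using open_components[OF open_nonzero D] in_components_connected[OF D] in_components_nonempty[OF D]
      in_components_subset[OF D] .
  have C': "connected C" "C \<noteq> {}" "C \<subseteq> frontier D"
    using in_components_connected[OF C] in_components_nonempty[OF C] in_components_subset[OF C] .
  have frD: "frontier D \<subseteq> {z. f z = 0}" "frontier D \<inter> D = {}"
    using frontier_of_components_subset[OF D] open_nonzero D'(1) by (auto simp: frontier_def interior_open)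
  have "C \<subseteq> - D" using C' frD by blast
  then obtain M where M: "M \<in> components (- D)" "C \<subseteq> M"
    using exists_component_superset[of C "- D"] C' by blast
  have clM: "closed M" using closed_components[OF _ M(1)] D'(1) by (simp add: closed_Compl)
  have MD: "M \<inter> D = {}" using in_components_subset[OF M(1)] by blast
  have U: "connected (- M)" using component_complement_connected[OF D'(2) M(1)] .
  have conn_fr: "connected (frontier M)" using connected_frontier_component_complement[OF D'(2) M(1)] .
  have frM: "frontier M \<subseteq> frontier D"
    using frontier_of_components_subset[OF M(1)] frontier_complement[of D] by simp
  have C_fr: "C \<subseteq> frontier M"
  proof
    fix x assume "x \<in> C"
    then have "x \<in> M" "x \<in> closure D" using M(2) C'(3) unfolding frontier_def by blast+
    moreover have "closure D \<subseteq> closure (- M)" using MD by (intro closure_mono) blast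
    ultimately show "x \<in> frontier M" using closure_subset unfolding frontier_closures by blast
  qed
  then have "frontier M \<subseteq> C"
    using components_maximal[OF C conn_fr frM] C'(2) by blast
  with C_fr have Ceq: "C = frontier M" by blast
  have CZ: "C \<subseteq> {z. f z = 0}" using C'(3) frD(1) by blast
  obtain s :: real where s: "s = 1 \<or> s = -1" "D \<subseteq> {z. 0 < s * f z}"
  proof -
    have "open {z. 0 < f z}" "open {z. f z < 0}" using cont by (auto intro!: open_Collect_less)
    then have "{z. 0 < f z} \<inter> D = {} \<or> {z. f z < 0} \<inter> D = {}"
      using D'(4) by (intro connectedD[OF D'(2)]) auto
    moreover have "f z < 0 \<or> 0 < f z" if "z \<in> D" for z
      using D'(4) that by force
    ultimately have "(\<forall>z\<in>D. f z < 0) \<or> (\<forall>z\<in>D. 0 < f z)"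
      by blast
    then show ?thesis using that[of 1] that[of "-1"] by auto
  qed
  \<comment> \<open>On \<open>N\<close> the sign of \<open>f\<close> is opposite to that on
    \<open>D\<close>. Both signs occur near every zero, so points of \<open>C\<close> are accessible
    from \<open>N\<close>. The arcs miss \<open>D\<close>, hence run in \<open>M\<close> and, except
    for the end point, in its interior.\<close>
  define N where "N = {z. s * f z < 0}"
  have oN: "open N" unfolding N_def using cont by (intro open_Collect_less continuous_intros) auto
  have frN: "frontier N \<subseteq> {z. f z = 0}"
  proof -
    have "closed {z. s * f z \<le> 0}" using cont by (intro closed_Collect_le continuous_intros) auto
    then have "closure N \<subseteq> {z. s * f z \<le> 0}" by (intro closure_minimal) (auto simp: N_def)
    then show ?thesis using s(1) oN unfolding frontier_def by (auto simp: interior_open N_def)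
  qed
  have ND: "N \<inter> D = {}" using s(2) unfolding N_def by fastforce
  have "C \<subseteq> closure (interior M)"
  proof
    fix p assume p: "p \<in> C"
    have "p \<notin> N" using p CZ unfolding N_def by auto
    moreover have "p \<in> closure N"
      unfolding closure_approachable
    proof (intro allI impI)
      fix e :: real assume e: "e > 0"
      have "f p = 0" using p CZ by blast
      then show "\<exists>y\<in>N. dist y p < e"
        using ex_less[OF e, of p] ex_greater[OF e, of p] s(1) unfolding N_def by (auto simp: dist_commute)
    qed
    ultimately have "p \<in> frontier N" using oN by (simp add: frontier_def interior_open)
    then have "accessible_from N p"
      using frN by (intro accessible_from_frontier[OF oN, of p 1]) auto
    then obtain g where g: "arc g" "pathstart g \<in> N" "pathfinish g = p" "path_image g - {p} \<subseteq> N"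
      using accessible_arc \<open>p \<notin> N\<close> by blast
    have "p \<in> path_image g" using g(3) pathfinish_in_path_image by blast
    moreover have "path_image g \<subseteq> - D" using g(4) ND p \<open>C \<subseteq> - D\<close> by blast
    ultimately have gM: "path_image g \<subseteq> M"
      using components_maximal[OF M(1) connected_arc_image[OF g(1)]] p M(2) by blast
    have "path_image g - {p} \<subseteq> interior M"
    proof
      fix x assume x: "x \<in> path_image g - {p}"
      then obtain r where r: "r > 0" "ball x r \<subseteq> N" using g(4) oN open_contains_ball by blast
      have "ball x r \<subseteq> - D" using r(2) ND by blast
      moreover have "x \<in> M \<inter> ball x r" using x gM r(1) by auto
      ultimately have "ball x r \<subseteq> M" using components_maximal[OF M(1) connected_ball] by blast
      then show "x \<in> interior M" using r(1) mem_interior by blast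
    qed
    moreover have "p islimpt path_image g"
    proof (rule connected_imp_perfect[OF connected_arc_image[OF g(1)] \<open>p \<in> path_image g\<close>])
      fix x
      have "pathstart g \<noteq> p" using g(2) \<open>p \<notin> N\<close> by blast
      then show "path_image g \<noteq> {x}" using \<open>p \<in> path_image g\<close> pathstart_in_path_image[of g] by auto
    qed
    ultimately show "p \<in> closure (interior M)"
      unfolding islimpt_in_closure using closure_mono by blast
  qed
  then have fr_int: "frontier M \<subseteq> closure (interior M)" using Ceq by blast
  have MU: "M \<noteq> UNIV" using MD D'(3) by blast
  have "connected (interior M)"
    by (rule connected_interior[OF clM MU U _ conn_fr fr_int]) (use CZ Ceq in blast)
  moreover have "frontier (interior M) = C"
  proof -
    have "frontier M \<inter> interior M = {}" unfolding frontier_def by blast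
    then have "frontier M \<subseteq> frontier (interior M)" using fr_int unfolding frontier_def by auto
    then show ?thesis using frontier_interior_subset[of M] Ceq by blast
  qed
  moreover have "C = - (interior M \<union> - M)"
    unfolding Ceq using clM by (auto simp: frontier_def)
  moreover have "frontier (- M) = C" using Ceq by (simp add: frontier_complement)
  moreover have "interior M \<inter> - M = {}" using interior_subset by blast
  moreover have "open (- M)" using clM by (simp add: open_Compl)
  ultimately show ?thesis using that[of "interior M" "- M"] CZ U by blast
qed

text \<open>The closed curve is described in inverted coordinates, with 0 for infinity. Its two
  halves come from \<open>arc_inside\<close>, applied once in the plane and once after
  inversion.\<close>

theorem component_frontier_simple_closed_curve:
  assumes "D \<in> components {z. f z \<noteq> 0}" and "C \<in> components (frontier D)"
  obtains c \<gamma> where "c \<notin> C" "simple_path \<gamma>" "pathfinish \<gamma> = pathstart \<gamma>" "path_image \<gamma> = insert 0 (invert c ` C)"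
proof -
  obtain G U where GU: "open G" "open U" "connected G" "connected U" "G \<inter> U = {}" and CGU: "C = - (G \<union> U)"
    and fr: "frontier G = C" "frontier U = C" and CZ: "C \<subseteq> {z. f z = 0}"
    using component_frontier_sides[OF assms] by blast
  have C: "connected C" "C \<noteq> {}" using in_components_connected[OF assms(2)] in_components_nonempty[OF assms(2)] .
  have clC: "closed C" using fr(1) frontier_closed by blast
  have "G \<noteq> {}" "U \<noteq> {}" using fr C(2) by auto
  then have unb: "\<not> bounded G" "\<not> bounded U"
    using unbounded_if_frontier_zero[of G] unbounded_if_frontier_zero[of U] GU fr C CZ by auto
  \<comment> \<open>Otherwise the connected complement of a large ball would lie in one of
    \<open>G\<close> and \<open>U\<close>, and the other would be bounded.\<close>
  have unbC: "\<not> bounded C"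
  proof
    assume "bounded C"
    then obtain r where r: "C \<subseteq> ball 0 r" using bounded_subset_ballD by blast
    have "connected (- ball (0::complex) r)" by (intro connected_complement_bounded_convex) auto
    then have "G \<inter> - ball 0 r = {} \<or> U \<inter> - ball 0 r = {}"
      by (rule connectedD) (use GU r CGU in auto)
    then have "G \<subseteq> ball 0 r \<or> U \<subseteq> ball 0 r" by blast
    then show False using unb bounded_ball bounded_subset by blast
  qed
  obtain a where a: "a \<in> C" using C(2) by blast
  obtain b where b: "b \<in> C" "a \<noteq> b"
  proof -
    have "C \<noteq> {a}" using unbC by auto
    then show ?thesis using that a by blast
  qed
  have acc: "accessible_from X p" if "X = G \<or> X = U" "p \<in> C" for X p
    using accessible_from_frontier[of X p 1] that fr GU CZ by auto
  obtain \<alpha> where \<alpha>: "arc \<alpha>" "pathstart \<alpha> = a" "pathfinish \<alpha> = b" "path_image \<alpha> - {a, b} \<subseteq> G"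
    using accessible_arc_between[OF GU(1,3) acc acc b(2)] a b(1) by blast
  obtain \<beta> where \<beta>: "arc \<beta>" "pathstart \<beta> = a" "pathfinish \<beta> = b" "path_image \<beta> - {a, b} \<subseteq> U"
    using accessible_arc_between[OF GU(2,4) acc acc b(2)] a b(1) by blast
  have "path_image \<alpha> \<inter> path_image \<beta> = {a, b}"
    using \<alpha> \<beta> GU(5) pathstart_in_path_image[of \<alpha>] pathfinish_in_path_image[of \<alpha>]
      pathstart_in_path_image[of \<beta>] pathfinish_in_path_image[of \<beta>] by auto
  then interpret A: two_arcs \<alpha> \<beta> a b
    by unfold_locales (use \<alpha> \<beta> in auto)
  \<comment> \<open>Every point of \<open>C\<close> is accessible here, so any point other than
    \<open>a\<close> and \<open>b\<close> can serve as the exceptional one.\<close>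
  obtain z where "z \<in> path_image \<alpha> - {a, b}" using arc_ex_inner_point[OF \<alpha>(1)] \<alpha>(2,3) by metis
  then have z: "z \<noteq> a" "z \<noteq> b" by auto
  obtain s1 where s1: "arc s1" "path_image s1 = insert a (insert b (C \<inter> inside A.J))" "pathstart s1 = a" "pathfinish s1 = b"
    using A.arc_inside[OF GU CGU C(1) \<alpha>(4) \<beta>(4) a b(1) z] acc by blast
  \<comment> \<open>The centre is chosen in \<open>G\<close> as well, near an inner point of
    \<open>\<alpha>\<close>. So it avoids \<open>C\<close> and \<open>U\<close>, and the inversion
    punctures \<open>G\<close> only.\<close>
  obtain c where c: "c \<in> inside A.J" "c \<in> G"
  proof -
    obtain x where x: "x \<in> path_image \<alpha> - {a, b}" using arc_ex_inner_point[OF \<alpha>(1)] \<alpha>(2,3) by metis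
    then have "x \<in> G" "x \<in> closure (inside A.J)"
      using \<alpha>(4) A.Jordan(11) unfolding A.J_def frontier_def by blast+
    then show ?thesis using that open_Int_closure_eq_empty[OF GU(1), of "inside A.J"] by blast
  qed
  have cn: "c \<notin> A.J" "c \<notin> U" "c \<notin> C" using c A.Jordan(10) GU(5) CGU by blast+
  have cab: "c \<noteq> a" "c \<noteq> b" using cn(3) a b by auto
  interpret B: two_arcs "invert c \<circ> \<alpha>" "invert c \<circ> \<beta>" "invert c a" "invert c b"
    using A.two_arcs_invert[OF cn(1)] .
  have BJ: "B.J = invert c ` A.J" unfolding B.J_def A.J_def path_image_compose by blast
  have insB: "inside B.J = insert 0 (invert c ` outside A.J)" unfolding BJ using A.inside_invert[OF c(1)] .
  define K where "K = insert 0 (invert c ` C)"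
  define G' where "G' = invert c ` (G - {c})"
  define U' where "U' = invert c ` U"
  have GU': "open G'" "open U'" "connected G'" "connected U'" "G' \<inter> U' = {}"
  proof -
    show "open G'" "open U'" unfolding G'_def U'_def using GU cn(2) by (auto intro!: open_invert_image open_delete)
    have "connected (G - {c})" using GU by (intro connected_open_delete) auto
    then show "connected G'" "connected U'"
      unfolding G'_def U'_def using GU cn(2) by (auto intro!: connected_invert_image)
    show "G' \<inter> U' = {}"
      unfolding G'_def U'_def image_Int[OF inj_invert, symmetric] using GU(5) by blast
  qed
  have K: "K = - (G' \<union> U')" "connected K"
  proof -
    have "- C - {c} = (G - {c}) \<union> U" using CGU cn(2) by blast
    then have "- K = G' \<union> U'"
      unfolding K_def G'_def U'_def compl_insert_invert_image[OF cn(3)] by (simp add: image_Un)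
    then show "K = - (G' \<union> U')" by blast
    show "connected K" unfolding K_def using connected_insert_invert_image[OF C(1) cn(3) unbC] .
  qed
  have subs: "path_image (invert c \<circ> \<alpha>) - {invert c a, invert c b} \<subseteq> G'"
    "path_image (invert c \<circ> \<beta>) - {invert c a, invert c b} \<subseteq> U'"
    using \<alpha>(4) \<beta>(4) cn(1) unfolding path_image_compose G'_def U'_def A.J_def by blast+
  have abK: "invert c a \<in> K" "invert c b \<in> K" using a b unfolding K_def by auto
  have access: "accessible_from G' p \<and> accessible_from U' p" if p: "p \<in> K \<inter> inside B.J" "p \<noteq> 0" for p
  proof -
    obtain q where q: "q \<in> C" "p = invert c q" using p unfolding K_def by blast
    have qc: "q \<noteq> c" using q cn(3) by blast
    have "accessible_from (G - {c}) q"
      using accessible_from_Diff_singleton[OF GU(1), of q c] q(1) fr(1) CZ qc by blast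
    then show ?thesis
      unfolding q(2) G'_def U'_def using accessible_from_invert[of _ q c] acc[of U q] q(1) qc cn(2) by auto
  qed
  \<comment> \<open>Accessibility is unknown at 0, the image of infinity, so 0 is the exceptional
    point.\<close>
  obtain s2 where s2: "arc s2" "path_image s2 = insert (invert c a) (insert (invert c b) (K \<inter> inside B.J))"
      "pathstart s2 = invert c a" "pathfinish s2 = invert c b"
    using B.arc_inside[OF GU' K subs abK, of 0] access cab by force
  have "K \<inter> inside B.J = insert 0 (invert c ` (C \<inter> outside A.J))"
    unfolding K_def insB image_Int[OF inj_invert] by blast
  then have im2: "path_image s2 = insert 0 (insert (invert c a) (insert (invert c b) (invert c ` (C \<inter> outside A.J))))"
    unfolding s2(2) by blast
  define \<gamma> where "\<gamma> = (invert c \<circ> s1) +++ reversepath s2"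
  have im1: "path_image (invert c \<circ> s1) = insert (invert c a) (insert (invert c b) (invert c ` (C \<inter> inside A.J)))"
    unfolding path_image_compose s1(2) by simp
  have ends: "pathstart (invert c \<circ> s1) = invert c a" "pathfinish (invert c \<circ> s1) = invert c b"
    using s1 by (simp_all add: pathstart_compose pathfinish_compose)
  have "path_image s1 \<subseteq> C" unfolding s1(2) using a b(1) by blast
  then have arc1: "arc (invert c \<circ> s1)"
    using arc_inj_image[OF s1(1) continuous_on_invert inj_invert] cn(3) by blast
  have "path_image (invert c \<circ> s1) \<inter> path_image s2 \<subseteq> {invert c a, invert c b}"
  proof -
    have "invert c ` (C \<inter> inside A.J) \<inter> invert c ` (C \<inter> outside A.J) = {}"
      unfolding image_Int[OF inj_invert, symmetric] using A.Jordan(9) by blast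
    moreover have "0 \<notin> path_image (invert c \<circ> s1)"
      using \<open>path_image s1 \<subseteq> C\<close> cn(3) unfolding path_image_compose by (auto simp: image_iff)
    moreover have "insert p (insert q X) \<inter> insert z (insert p (insert q Y)) \<subseteq> {p, q}"
      if "X \<inter> Y = {}" "z \<notin> insert p (insert q X)" for p q z :: complex and X Y
      using that by auto
    ultimately show ?thesis unfolding im2 im1 by presburger
  qed
  then have "simple_path \<gamma>"
    unfolding \<gamma>_def using arc1 s2 ends by (auto simp: simple_path_join_loop_eq arc_reversepath)
  moreover have "pathfinish \<gamma> = pathstart \<gamma>" unfolding \<gamma>_def using s2 ends by simp
  moreover have "path_image \<gamma> = insert 0 (invert c ` C)"
  proof -
    have CJ: "C \<inter> A.J = {a, b}"
    proof -
      have "C \<inter> G = {}" "C \<inter> U = {}" using CGU by blast+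
      then have "C \<inter> path_image \<alpha> \<subseteq> {a, b}" "C \<inter> path_image \<beta> \<subseteq> {a, b}" using \<alpha>(4) \<beta>(4) by blast+
      then show ?thesis using a b A.ab unfolding A.J_def by blast
    qed
    have "C = {a, b} \<union> (C \<inter> inside A.J) \<union> (C \<inter> outside A.J)"
      using A.Jordan(10) CJ by blast
    then have "invert c ` C = invert c ` ({a, b} \<union> (C \<inter> inside A.J) \<union> (C \<inter> outside A.J))"
      by (rule arg_cong)
    moreover have "path_image \<gamma> = path_image (invert c \<circ> s1) \<union> path_image s2"
      unfolding \<gamma>_def using s2 ends by (simp add: path_image_join)
    ultimately show ?thesis
      unfolding im1 im2 by (simp add: image_Un Un_ac insert_commute)
  qed
  ultimately show ?thesis using that cn(3) by blast
qed

end

section \<open>Transfer to the sphere\<close>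

definition plane_of :: "complex \<Rightarrow> real^2" where
  "plane_of z = vector [Re z, Im z]"

definition complex_of :: "real^2 \<Rightarrow> complex" where
  "complex_of x = Complex (x $ 1) (x $ 2)"

lemma complex_of_plane_of [simp]: "complex_of (plane_of z) = z" "plane_of (complex_of x) = x"
  unfolding plane_of_def complex_of_def by (simp_all add: vec_eq_iff forall_2)

lemma linear_plane_of: "linear plane_of"
  unfolding plane_of_def by (rule linearI) (simp_all add: vec_eq_iff forall_2)

lemma linear_complex_of: "linear complex_of"
  unfolding complex_of_def by (rule linearI) (simp_all add: complex_eq_iff)

lemma homeomorphism_complex_of: "homeomorphism UNIV UNIV complex_of plane_of"
  unfolding homeomorphism_def
  using linear_continuous_on linear_conv_bounded_linear linear_plane_of linear_complex_of
  by (metis UNIV_eq_I complex_of_plane_of image_eqI UNIV_I)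

lemma components_homeomorphism_image:
  assumes "homeomorphism UNIV UNIV h k" "C \<in> components S"
  shows "h ` C \<in> components (h ` S)"
proof -
  have kh: "k (h x) = x" and hk: "h (k y) = y" for x y
    using assms(1) unfolding homeomorphism_def by auto
  have conn_h: "connected (h ` X)" if "connected X" for X
    using assms(1) that connected_continuous_image continuous_on_subset subset_UNIV
    unfolding homeomorphism_def by metis
  have conn_k: "connected (k ` Y)" if "connected Y" for Y
    using assms(1) that connected_continuous_image continuous_on_subset subset_UNIV
    unfolding homeomorphism_def by metis
  have "T = h ` C" if T: "h ` C \<subseteq> T" "T \<subseteq> h ` S" "connected T" for T
  proof -
    have "k ` h ` X = X" for X by (simp add: image_image kh)
    then have "C \<subseteq> k ` T" "k ` T \<subseteq> S" using T(1,2) by (metis image_mono)+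
    then have "k ` T \<subseteq> C"
      using components_maximal[OF assms(2) conn_k[OF T(3)]] in_components_nonempty[OF assms(2)] by blast
    then have "h ` k ` T \<subseteq> h ` C" by blast
    then show ?thesis using T(1) by (simp add: image_image hk)
  qed
  then show ?thesis
    using in_components_nonempty[OF assms(2)] in_components_subset[OF assms(2)]
      conn_h[OF in_components_connected[OF assms(2)]]
    unfolding in_components_maximal by (simp add: image_mono)
qed

lemma frontier_homeomorphism_image:
  fixes h :: "'a::euclidean_space \<Rightarrow> 'b::euclidean_space"
  assumes "linear h" "bij h"
  shows "frontier (h ` S) = h ` frontier S"
  unfolding frontier_def
  using interior_bijective_linear_image[OF assms] closure_injective_linear_image[OF assms(1)] assms(2)
  by (simp add: image_set_diff bij_def)

text \<open>The map undoes \<open>invert c\<close> and sends 0 to infinity. A neighbourhood of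
  \<open>None\<close> omits a compact set \<open>K\<close>, whose preimage stays away from 0 and is
  therefore closed.\<close>

lemma continuous_map_invert_compactification:
  "continuous_map euclidean S2 (\<lambda>w. if w = 0 then None else Some (plane_of (c + inverse w)))"
  (is "continuous_map _ _ ?\<Phi>")
  unfolding continuous_map_def
proof (intro conjI allI impI)
  show "?\<Phi> \<in> topspace euclidean \<rightarrow> topspace S2" by auto
  have cont: "continuous_on X (\<lambda>w. plane_of (c + inverse w))" if "0 \<notin> X" for X
    using that by (intro continuous_on_compose2[OF linear_continuous_on[OF linear_plane_of[unfolded linear_conv_bounded_linear]]] continuous_intros) auto
  fix V assume "openin S2 V"
  then consider U where "open U" "V = Some ` U" | K where "compact K" "V = insert None (Some ` (- K))"
    by (auto simp: openin_Alexandroff_compactification Compl_eq_Diff_UNIV)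
  then have "open {w. ?\<Phi> w \<in> V}"
  proof cases
    case 1
    then have "{w. ?\<Phi> w \<in> V} = - {0} \<inter> (\<lambda>w. plane_of (c + inverse w)) -` U" by auto
    moreover have "open (- {0} \<inter> (\<lambda>w. plane_of (c + inverse w)) -` U)"
      using 1(1) by (intro continuous_open_preimage cont) auto
    ultimately show ?thesis by simp
  next
    case 2
    obtain r where r: "r > 0" "\<And>x. x \<in> complex_of ` K \<Longrightarrow> dist c x \<le> r"
    proof -
      have "bounded (complex_of ` K)"
        using bounded_linear_image[OF compact_imp_bounded[OF 2(1)]] linear_complex_of linear_conv_bounded_linear by blast
      then obtain r where "r > 0" "complex_of ` K \<subseteq> ball c r" using bounded_subset_ballD by blast
      then show ?thesis using that[of r] by fastforce
    qed
    \<comment> \<open>As \<open>inverse 0 = 0\<close>, the formula gives \<open>plane_of c\<close>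
      at 0, which may lie in \<open>K\<close>. The bound \<open>1 / r\<close> excludes 0, where the
      formula is also discontinuous, and loses no other point.\<close>
    define F where "F = {w::complex. 1 / r \<le> norm w} \<inter> (\<lambda>w. plane_of (c + inverse w)) -` K"
    have "closed F"
      unfolding F_def
    proof (rule continuous_closed_preimage)
      show "continuous_on {w. 1 / r \<le> norm w} (\<lambda>w. plane_of (c + inverse w))"
        by (rule cont) (use r(1) in auto)
      show "closed {w::complex. 1 / r \<le> norm w}" by (intro closed_Collect_le continuous_intros)
    qed (use 2(1) compact_imp_closed in auto)
    moreover have "{w. ?\<Phi> w \<in> V} = - F"
    proof -
      have "1 / r \<le> norm w" if "w \<noteq> 0" "plane_of (c + inverse w) \<in> K" for w
      proof -
        have "c + inverse w \<in> complex_of ` K" using that(2) complex_of_plane_of(1) by (metis image_eqI)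
        moreover have "dist c (c + inverse w) = inverse (norm w)" by (simp add: dist_norm norm_inverse)
        ultimately have "inverse (norm w) \<le> r" using r(2) by metis
        then show ?thesis using r(1) that(1) by (simp add: field_simps)
      qed
      moreover have "0 \<notin> F" unfolding F_def using r(1) by auto
      ultimately show ?thesis unfolding 2(2) F_def by auto
    qed
    ultimately show ?thesis by (simp add: open_Compl)
  qed
  then show "openin euclidean {w \<in> topspace euclidean. ?\<Phi> w \<in> V}" by simp
qed

lemma regular_functionI:
  fixes f :: "complex \<Rightarrow> real"
  assumes der: "\<And>z. (f has_derivative f' z) (at z)" and nz: "\<And>z. f' z \<noteq> (\<lambda>_. 0)"
  shows "regular_function f"
proof
  show "continuous_on UNIV f" using der has_derivative_continuous_on by blast
  show "\<exists>c d. p \<in> box c d \<and> cbox c d \<subseteq> ball p e \<and> finite (components ({z. f z \<noteq> 0} \<inter> cbox c d))"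
    if "e > 0" for e p
    using ex_box_finite_components[of f f' e p] der nz that by metis
  show "\<exists>w\<in>ball z e. f z < f w" if "e > 0" for z e
    using differential_zero_maxmin[of z "ball z e" f "f' z"] der nz that by force
  show "\<exists>w\<in>ball z e. f w < f z" if "e > 0" for z e
    using differential_zero_maxmin[of z "ball z e" f "f' z"] der nz that by force
qed

theorem corollary2p8:
  fixes f :: "real^2 \<Rightarrow> real" and D C :: "(real^2) set"
  assumes "\<And>x. f differentiable (at x)"
    and "\<And>x v. GDERIV f x :> v \<Longrightarrow> v \<noteq> 0"
    and "D \<in> components {x. f x \<noteq> 0}"
    and "C \<in> components (frontier D)"
  shows "Jordan_curve_in S2 (insert None (Some ` C))"
proof -
  obtain f' where f': "\<And>x. (f has_derivative f' x) (at x)"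
    using assms(1) unfolding differentiable_def by metis
  define F where "F = f \<circ> plane_of"
  have derF: "(F has_derivative (f' (plane_of z) \<circ> plane_of)) (at z)" for z
    unfolding F_def
    by (intro diff_chain_at f' bounded_linear_imp_has_derivative)
      (use linear_plane_of linear_conv_bounded_linear in blast)
  have nzF: "f' (plane_of z) \<circ> plane_of \<noteq> (\<lambda>_. 0)" for z
  proof
    assume eq: "f' (plane_of z) \<circ> plane_of = (\<lambda>_. 0)"
    have "f' (plane_of z) h = 0" for h
      using fun_cong[OF eq, of "complex_of h"] by simp
    then have "f' (plane_of z) = (\<lambda>h. inner h 0)" by auto
    then have "GDERIV f (plane_of z) :> 0" using f'[of "plane_of z"] unfolding gderiv_def by simp
    then show False using assms(2) by blast
  qed
  interpret regular_function F by (rule regular_functionI[OF derF nzF])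
  have bij: "bij complex_of" by (metis bijI' complex_of_plane_of)
  have "complex_of ` {x. f x \<noteq> 0} = {z. F z \<noteq> 0}"
    unfolding F_def by (auto simp: image_iff) (metis complex_of_plane_of(1,2))
  then have D: "complex_of ` D \<in> components {z. F z \<noteq> 0}"
    using components_homeomorphism_image[OF homeomorphism_complex_of assms(3)] by simp
  have C: "complex_of ` C \<in> components (frontier (complex_of ` D))"
    using components_homeomorphism_image[OF homeomorphism_complex_of assms(4)]
      frontier_homeomorphism_image[OF linear_complex_of bij] by simp
  obtain c \<gamma> where \<gamma>: "c \<notin> complex_of ` C" "simple_path \<gamma>" "pathfinish \<gamma> = pathstart \<gamma>"
      "path_image \<gamma> = insert 0 (invert c ` complex_of ` C)"
    using component_frontier_simple_closed_curve[OF D C] .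
  have "sphere (0::real^2) 1 homeomorphic path_image \<gamma>"
  proof -
    have "path_image \<gamma> homeomorphic sphere (0::complex) 1"
      using homeomorphic_simple_path_image_circle[OF \<gamma>(2,3)] by simp
    also have "sphere (0::complex) 1 homeomorphic sphere (0::real^2) 1"
      by (rule homeomorphic_spheres_gen) auto
    finally show ?thesis using homeomorphic_sym by blast
  qed
  then obtain h h' where h: "homeomorphism (sphere (0::real^2) 1) (path_image \<gamma>) h h'"
    unfolding homeomorphic_def by blast
  define \<Phi> where "\<Phi> w = (if w = 0 then None else Some (plane_of (c + inverse w)))" for w
  have inj: "inj \<Phi>"
    unfolding \<Phi>_def
    by (rule injI) (metis add_left_cancel complex_of_plane_of(1) inverse_inverse_eq option.inject option.distinct(1))
  have "continuous_map (top_of_set (sphere (0::real^2) 1)) euclidean h"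
    using h unfolding homeomorphism_def by simp
  then have "continuous_map (top_of_set (sphere (0::real^2) 1)) S2 (\<Phi> \<circ> h)"
    using continuous_map_invert_compactification[of c] continuous_map_compose unfolding \<Phi>_def by blast
  moreover have "inj_on (\<Phi> \<circ> h) (sphere 0 1)"
  proof (rule comp_inj_on)
    show "inj_on h (sphere 0 1)" using h unfolding homeomorphism_def by (metis inj_on_inverseI)
    show "inj_on \<Phi> (h ` sphere 0 1)" using inj inj_on_subset by blast
  qed
  moreover have "insert None (Some ` C) = (\<Phi> \<circ> h) ` sphere 0 1"
  proof -
    have "(\<Phi> \<circ> h) ` sphere 0 1 = \<Phi> ` path_image \<gamma>"
      using h unfolding homeomorphism_def image_comp[symmetric] by simp
    also have "\<dots> = insert None ((\<lambda>x. \<Phi> (invert c (complex_of x))) ` C)"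
    proof -
      have "\<Phi> 0 = None" unfolding \<Phi>_def by simp
      then show ?thesis unfolding \<gamma>(4) by (simp only: image_insert image_image)
    qed
    also have "(\<lambda>x. \<Phi> (invert c (complex_of x))) ` C = Some ` C"
    proof (rule image_cong[OF refl])
      fix x assume "x \<in> C"
      then have "complex_of x \<noteq> c" using \<gamma>(1) by blast
      then show "\<Phi> (invert c (complex_of x)) = Some x"
        unfolding \<Phi>_def by simp
    qed
    finally show ?thesis by simp
  qed
  ultimately show ?thesis unfolding Jordan_curve_in_def by blast
qed

end
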